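(* Let $G$ be a Šunić group (for any prime $p$ and any admissible defining polynomial) which is not the infinite dihedral group. Then $G$ has the congruence subgroup property: every finite index subgroup of $G$ contains the level stabilizer $\mathrm{St}_G(n)$ for some $n\in\mathbb N$.
   Context: Let $p$ be a prime, $X=\{\mathbf 0,\dots,\mathbf{p-1}\}$ and $T$ the $p$-regular rooted tree with vertex set $X^*$ (finite words; $w$ is joined to $wx$ for $x\in X$); level $n$ is $X^n$. For $G\le \mathrm{Aut}\,T$, $\mathrm{St}_G(n)$ is the pointwise stabilizer in $G$ of $X^n$. For $g\in\mathrm{Aut}\,T$ and a vertex $v$, $g_v\in\mathrm{Aut}\,T$ is the unique automorphism with $g(vw)=g(v)g_v(w)$ for all $w$; if $g$ fixes the first level pointwise, write $\psi(g)=(g_{\mathbf 0},\dots,g_{\mathbf{p-1}})$. Šunić groups: let $f(x)=x^m+a_{m-1}x^{m-1}+\dots+a_1x+a_0\in\mathbb F_p[x]$ with $m\ge1$, $a_0\ne0$. Let $B\cong(\mathbb Z/p)^m$ be written multiplicatively with basis $b_0,\dots,b_{m-1}$; let $\rho\colon B\to B$ be the automorphism with $\rho(b_i)=b_{i+1}$ for $0\le i\le m-2$ and $\rho(b_{m-1})=b_0^{-a_0}b_1^{-a_1}\cdots b_{m-1}^{-a_{m-1}}$. Let $A=\langle a\rangle$ be cyclic of order $p$ and $\omega\colon B\to A$ the homomorphism with $\omega(b_i)=1$ for $i\le m-2$ and $\omega(b_{m-1})=a$. Then $a$ acts on $T$ by $a(xw)=\sigma(x)w$ for $x\in X$, where $\sigma=(\mathbf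 0\ \mathbf 1\ \dots\ \mathbf{p-1})$, and $y\in B$ acts recursively by fixing the first level with $\psi(y)=(\omega(y),1,\dots,1,\rho(y))$. These actions are faithful, and the Šunić group is $G_{p,f}:=\langle A\cup B\rangle\le\mathrm{Aut}\,T$. The infinite dihedral group is the case $p=2$, $f=x+1$ (i.e. $p=2$, $m=1$). *)

theory Defs
  imports
    "HOL-Algebra.Bij"
    "HOL-Algebra.Elementary_Groups"
    "Jordan_Normal_Form.Matrix"
    "Berlekamp_Zassenhaus.Finite_Field"
begin

text \<open>
  The prime \<open>p\<close> is \<open>CARD('p)\<close> for a type \<open>'p :: prime_card\<close>, and \<open>'p mod_ring\<close> is the field with
  \<open>p\<close> elements. It also serves as the alphabet \<open>X\<close>: the letters \<open>0, \<dots>, p - 1\<close> are the residues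
  modulo \<open>p\<close>. In particular \<open>-1\<close> is the letter \<open>p - 1\<close>, and the cycle \<open>(0 1 \<dots> p-1)\<close> is
  \<open>\<lambda>x. x + 1\<close>.
\<close>

section \<open>Automorphisms of the rooted tree of words\<close>

definition tree_edge :: "'x list \<Rightarrow> 'x list \<Rightarrow> bool" where
  "tree_edge u v \<longleftrightarrow> (\<exists>x. v = u @ [x] \<or> u = v @ [x])"

text \<open>The product \<open>g \<otimes> h\<close> is \<open>g \<circ> h\<close>, i.e. automorphisms act on the left.\<close>

definition Aut_tree :: "('x list \<Rightarrow> 'x list) monoid" where
  "Aut_tree = (BijGroup UNIV)
     \<lparr>carrier := {g \<in> Bij UNIV. g [] = [] \<and> (\<forall>u v. tree_edge (g u) (g v) \<longleftrightarrow> tree_edge u v)}\<rparr>"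

definition level_stabilizer :: "('x list \<Rightarrow> 'x list) monoid \<Rightarrow> nat \<Rightarrow> ('x list \<Rightarrow> 'x list) set" where
  "level_stabilizer G n = {g \<in> carrier G. \<forall>v. length v = n \<longrightarrow> g v = v}"

definition congruence_subgroup_property :: "('x list \<Rightarrow> 'x list) monoid \<Rightarrow> bool" where
  "congruence_subgroup_property G \<longleftrightarrow>
     (\<forall>H. subgroup H G \<and> finite (rcosets\<^bsub>G\<^esub> H) \<longrightarrow> (\<exists>n. level_stabilizer G n \<subseteq> H))"


section \<open>Sunic groups\<close>

text \<open>
  The groups \<open>A\<close> and \<open>B\<close> are written additively: \<open>k\<close> in \<open>'p mod_ring\<close> stands for \<open>a\<^sup>k\<close>, and a
  vector \<open>y\<close> of dimension \<open>m = degree f\<close> stands for the product of the \<open>b\<^sub>i\<close> to the power \<open>y $ i\<close>.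
\<close>

definition rho_basis :: "'p::prime_card mod_ring poly \<Rightarrow> nat \<Rightarrow> 'p mod_ring vec" where
  "rho_basis f i =
     (if i + 1 < degree f then unit_vec (degree f) (i + 1)
      else vec (degree f) (\<lambda>j. - coeff f j))"

definition rho :: "'p::prime_card mod_ring poly \<Rightarrow> 'p mod_ring vec \<Rightarrow> 'p mod_ring vec" where
  "rho f y = mat_of_cols (degree f) (map (rho_basis f) [0..<degree f]) *\<^sub>v y"

definition omega :: "'p::prime_card mod_ring poly \<Rightarrow> 'p mod_ring vec \<Rightarrow> 'p mod_ring" where
  "omega f y = y $ (degree f - 1)"

fun act_A :: "'p::prime_card mod_ring \<Rightarrow> 'p mod_ring list \<Rightarrow> 'p mod_ring list" where
  "act_A k [] = []"
| "act_A k (x # w) = (x + k) # w"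

fun act_B :: "'p::prime_card mod_ring poly \<Rightarrow> 'p mod_ring vec \<Rightarrow>
    'p mod_ring list \<Rightarrow> 'p mod_ring list" where
  "act_B f y [] = []"
| "act_B f y (x # w) =
     x # (if x = 0 then act_A (omega f y) w
          else if x = -1 then act_B f (rho f y) w
          else w)"

definition sunic_group ::
    "'p::prime_card mod_ring poly \<Rightarrow> ('p mod_ring list \<Rightarrow> 'p mod_ring list) monoid" where
  "sunic_group f = subgroup_generated Aut_tree
     (range act_A \<union> act_B f ` carrier_vec (degree f))"


text \<open>
  The library construction \<open>subgroup_generated\<close> discards generators outside the carrier; the remaining
  lemmas show that this does not happen here.
\<close>

lemma Aut_treeI:
  assumes inv1: "\<And>w. h (g w) = w" and inv2: "\<And>w. g (h w) = w"
    and root: "g [] = []"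
    and len: "\<And>w. length (g w) = length w"
    and g_snoc: "\<And>w x. butlast (g (w @ [x])) = g w"
  shows "g \<in> carrier Aut_tree"
proof -
  have edge: "tree_edge u v \<longleftrightarrow> (v \<noteq> [] \<and> butlast v = u) \<or> (u \<noteq> [] \<and> butlast u = v)"
    for u v :: "'a list"
  proof -
    have snoc: "(\<exists>x. v = u @ [x]) \<longleftrightarrow> v \<noteq> [] \<and> butlast v = u" for u v :: "'a list"
      by (cases v rule: rev_cases) auto
    show ?thesis unfolding tree_edge_def ex_disj_distrib snoc ..
  qed
  have ne: "g w = [] \<longleftrightarrow> w = []" for w using len[of w] by (cases w) auto
  have gb: "v \<noteq> [] \<Longrightarrow> butlast (g v) = g (butlast v)" for v
    using g_snoc[of "butlast v" "last v"] by simp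
  have inj: "g u = g v \<longleftrightarrow> u = v" for u v by (metis inv1)
  have half: "g v \<noteq> [] \<and> butlast (g v) = g u \<longleftrightarrow> v \<noteq> [] \<and> butlast v = u" for u v
    by (cases "v = []") (simp_all add: ne gb inj root)
  have "tree_edge (g u) (g v) \<longleftrightarrow> tree_edge u v" for u v
    unfolding edge half ..
  moreover have "bij g" by (rule o_bij[of h]) (auto simp: inv1 inv2)
  ultimately show ?thesis
    using root by (simp add: Aut_tree_def Bij_def extensional_def)
qed

lemma act_A_in_Aut_tree: "act_A k \<in> carrier Aut_tree"
proof (rule Aut_treeI[where h = "act_A (- k)"])
  have inv: "act_A (- k) (act_A k w) = w" for k :: "'a mod_ring" and w by (cases w) auto
  show "act_A (- k) (act_A k w) = w" "act_A k (act_A (- k) w) = w" for w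
    using inv[of k] inv[of "- k"] by simp_all
  show "act_A k [] = []" "length (act_A k w) = length w" for w by (cases w; simp)+
  have "butlast (act_A k (w @ [x])) = act_A k w" for k x and w :: "'a mod_ring list"
    by (cases w) auto
  then show "butlast (act_A k (w @ [x])) = act_A k w" for w x by blast
qed

lemma rho_carrier: "rho f y \<in> carrier_vec (degree f)"
  by (rule carrier_vecI) (simp add: rho_def)

lemma act_B_in_Aut_tree:
  assumes "degree f \<ge> 1" and y: "y \<in> carrier_vec (degree f)"
  shows "act_B f y \<in> carrier Aut_tree"
proof (rule Aut_treeI[where h = "act_B f (- y)"])
  have A: "act_A (- k) (act_A k w) = w" for k :: "'a mod_ring" and w by (cases w) auto
  have rho_neg: "rho f (- y) = - rho f y" if "y \<in> carrier_vec (degree f)" for y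
    using that by (auto simp: rho_def intro!: eq_vecI)
  have om_neg: "omega f (- y) = - omega f y" if "y \<in> carrier_vec (degree f)" for y
    using that assms(1) by (auto simp: omega_def)
  have inv: "act_B f (- y) (act_B f y w) = w" if "y \<in> carrier_vec (degree f)" for y w
    using that
  proof (induction w arbitrary: y)
    case (Cons x w)
    then show ?case using rho_carrier[of f y] by (auto simp: rho_neg om_neg A)
  qed simp
  show "act_B f (- y) (act_B f y w) = w" for w using inv y by blast
  show "act_B f y (act_B f (- y) w) = w" for w
    using inv[of "- y" w] y by simp
  show "act_B f y [] = []" by simp
  have lA: "length (act_A k w) = length w" for k :: "'a mod_ring" and w by (cases w) auto
  show "length (act_B f y w) = length w" for w
    by (induction w arbitrary: y) (auto simp: lA)
  have bA: "butlast (act_A k (w @ [x])) = act_A k w" for k x and w :: "'a mod_ring list"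
    by (cases w) auto
  have neA: "act_A k (w @ [x]) \<noteq> []" for k x and w :: "'a mod_ring list"
    by (cases w) auto
  have neB: "act_B f y (w @ [x]) \<noteq> []" for y x and w :: "'a mod_ring list"
    by (cases w) auto
  have "butlast (act_B f y (w @ [x])) = act_B f y w" for w x y
    by (induction w arbitrary: y) (auto simp: bA neA neB)
  then show "butlast (act_B f y (w @ [x])) = act_B f y w" for w x by blast
qed

end

theory Submission
  imports Defs
begin

text \<open>
  \<open>G\<close> is a branch group over a normal subgroup \<open>K\<close>: a copy of \<open>K\<close> at any vertex lies in \<open>K\<close>. Here
  \<open>K\<close> is the normal closure of the commutators of \<open>A\<close> with \<open>rho B0\<close>, where \<open>B0\<close> is \<open>B\<close> for odd \<open>p\<close>
  and the kernel of \<open>omega\<close> for \<open>p = 2\<close>. The generators of \<open>K\<close> at a child of the root are commutators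
  \<open>[z, a y a\<inverse>]\<close> with \<open>z\<close> in \<open>rho B0\<close> and \<open>y\<close> in \<open>B0\<close>, which equal \<open>[[z, a], a y a\<inverse>]\<close> because \<open>z\<close>
  and \<open>y\<close> commute; so they even lie in \<open>[K, G]\<close>.

  Let \<open>N\<close> be a nontrivial normal subgroup. It moves some vertex \<open>v\<close>, and a double commutator shows
  that it contains \<open>[K, K]\<close> at \<open>v\<close>. Some vertex \<open>u\<close> has the property that the elements of \<open>K\<close>
  fixing \<open>u\<close> have all of \<open>G\<close> as sections at \<open>u\<close>; so \<open>N\<close> contains \<open>[K, G]\<close> at \<open>vu\<close> and hence
  \<open>K\<close> at a child of \<open>vu\<close>. By transitivity \<open>N\<close> contains \<open>K\<close> at all vertices of one level.

  It remains to see that \<open>K\<close> contains a level stabilizer. If a word with exponent sums \<open>t\<close> in \<open>A\<close> and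
  \<open>y\<close> in \<open>B\<close> represents \<open>g\<close>, then the exponent sums of its sections at the letters add up to \<open>omega y\<close>
  and \<open>rho y\<close>. So if \<open>g\<close> fixes level \<open>m + 1\<close>, then \<open>t = 0\<close> and \<open>omega (rho\<^sup>j y) = 0\<close> for all
  \<open>j < m\<close>, which forces \<open>y = 0\<close>, so \<open>g\<close> lies in the commutator subgroup. For odd \<open>p\<close> this is \<open>K\<close>;
  for \<open>p = 2\<close> it is \<open>K\<close> together with one more coset, which the same sums exclude.
\<close>

unbundle no m_inv_syntax

section \<open>The companion matrix action\<close>

lemma rho_index:
  assumes y: "y \<in> carrier_vec (degree f)" and j: "j < degree f"
  shows "rho f y $ j = (if j = 0 then 0 else y $ (j - 1)) - y $ (degree f - 1) * coeff f j"
proof -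
  let ?m = "degree f"
  have "rho f y $ j = (\<Sum>i<?m. rho_basis f i $ j * y $ i)"
    using y j by (auto simp: rho_def scalar_prod_def mat_of_cols_index lessThan_atLeast0 intro!: sum.cong)
  \<comment> \<open>The guard on \<open>j\<close> is there because \<open>j - 1\<close> is truncated
    subtraction.\<close>
  also have "\<dots> = (\<Sum>i<?m. (if i = j - 1 \<and> j \<noteq> 0 then y $ (j - 1) else 0)
      + (if i = ?m - 1 then - (y $ (?m - 1) * coeff f j) else 0))"
    by (rule sum.cong) (use j in \<open>auto simp: rho_basis_def unit_vec_def\<close>)
  also have "\<dots> = (if j = 0 then 0 else y $ (j - 1)) - y $ (?m - 1) * coeff f j"
    using j by (cases "j = 0") (auto simp: sum.distrib sum.delta)
  finally show ?thesis .
qed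

lemma rho_closed [simp]: "rho f y \<in> carrier_vec (degree f)"
  by (rule rho_carrier)

lemma dim_rho [simp]: "dim_vec (rho f y) = degree f"
  using rho_closed by (rule carrier_vecD)

lemma rho_add:
  assumes "y \<in> carrier_vec (degree f)" "z \<in> carrier_vec (degree f)"
  shows "rho f (y + z) = rho f y + rho f z"
  using assms by (intro eq_vecI) (auto simp: rho_index algebra_simps)

lemma rho_uminus:
  assumes "y \<in> carrier_vec (degree f)"
  shows "rho f (- y) = - rho f y"
  using assms by (intro eq_vecI) (auto simp: rho_index)

lemma rho_zero: "rho f (0\<^sub>v (degree f)) = 0\<^sub>v (degree f)"
  by (intro eq_vecI) (auto simp: rho_index)

lemma rho_surj:
  assumes m: "degree f \<ge> 1" and a0: "coeff f 0 \<noteq> 0" and z: "z \<in> carrier_vec (degree f)"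
  shows "\<exists>y \<in> carrier_vec (degree f). rho f y = z"
proof -
  let ?m = "degree f"
  \<comment> \<open>Coordinate 0 of the image is \<open>- c * coeff f 0\<close>, which forces the
    last coordinate \<open>c\<close>; the others follow from the shift.\<close>
  define c where "c = - z $ 0 / coeff f 0"
  define y where "y = vec ?m (\<lambda>j. if j = ?m - 1 then c else z $ (j + 1) + c * coeff f (j + 1))"
  have y: "y \<in> carrier_vec ?m" and last: "y $ (?m - 1) = c"
    using m by (auto simp: y_def)
  have "rho f y = z"
  proof (rule eq_vecI)
    fix j assume "j < dim_vec z"
    then have j: "j < ?m" using z by auto
    then show "rho f y $ j = z $ j"
      unfolding rho_index[OF y j] last
      using a0 by (cases "j = 0") (auto simp: y_def c_def)
  qed (use z in \<open>auto simp: rho_def\<close>)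
  then show ?thesis using y by auto
qed

text \<open>As \<open>coeff f 0\<close> is nonzero, coordinate 0 of the image determines the last
  coordinate; with that known, the image is a shift and reveals the others.\<close>

lemma rho_inj:
  assumes a0: "coeff f 0 \<noteq> 0" and y: "y \<in> carrier_vec (degree f)" and z: "z \<in> carrier_vec (degree f)"
    and eq: "rho f y = rho f z"
  shows "y = z"
proof (rule eq_vecI)
  let ?m = "degree f"
  have e: "(if j = 0 then 0 else y $ (j - 1)) - y $ (?m - 1) * coeff f j
      = (if j = 0 then 0 else z $ (j - 1)) - z $ (?m - 1) * coeff f j" if "j < ?m" for j
    using eq rho_index[OF y that] rho_index[OF z that] by simp
  have last: "y $ (?m - 1) = z $ (?m - 1)" if "?m > 0"
    using e[of 0] a0 that by simp
  fix i assume "i < dim_vec z"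
  then have i: "i < ?m" using z by auto
  show "y $ i = z $ i"
  proof (cases "i = ?m - 1")
    case True
    then show ?thesis using last i by simp
  next
    case False
    then show ?thesis using e[of "i + 1"] last i by simp
  qed
qed (use y z in auto)

lemma omega_add:
  "degree f \<ge> 1 \<Longrightarrow> y \<in> carrier_vec (degree f) \<Longrightarrow> z \<in> carrier_vec (degree f) \<Longrightarrow>
    omega f (y + z) = omega f y + omega f z"
  by (auto simp: omega_def)

lemma omega_uminus:
  "degree f \<ge> 1 \<Longrightarrow> y \<in> carrier_vec (degree f) \<Longrightarrow> omega f (- y) = - omega f y"
  by (auto simp: omega_def)

lemma omega_zero: "degree f \<ge> 1 \<Longrightarrow> omega f (0\<^sub>v (degree f)) = 0"
  by (auto simp: omega_def)

lemma act_A_add: "act_A k (act_A l w) = act_A (k + l) w"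
  by (cases w) (auto simp: algebra_simps)

lemma act_A_0 [simp]: "act_A 0 w = w"
  by (cases w) auto

lemma inv_act_A: "inv (act_A k) = act_A (- k)"
  by (rule inv_unique_comp) (auto simp: fun_eq_iff act_A_add)

lemma bij_act_A: "bij (act_A k)"
  by (rule o_bij[of "act_A (- k)"]) (auto simp: fun_eq_iff act_A_add)

lemma mod_ring_minus_one_neq_one:
  assumes "CARD('p::prime_card) \<noteq> 2"
  shows "(- 1 :: 'p mod_ring) \<noteq> 1"
proof
  assume "(- 1 :: 'p mod_ring) = 1"
  then have "of_nat 2 = (0 :: 'p mod_ring)" by (simp add: minus_equation_iff eq_neg_iff_add_eq_0)
  then have "CARD('p) dvd 2" by (rule of_nat_0_mod_ring_dvd)
  then have "CARD('p) \<le> 2" by (rule dvd_imp_le) simp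
  then show False using assms prime_gt_1_nat[OF prime_card[where 'a='p]] by linarith
qed

lemma mod_ring_2_cases:
  assumes "CARD('p::prime_card) = 2"
  shows "(x :: 'p mod_ring) = 0 \<or> x = 1"
proof -
  have "{0, 1} = (UNIV :: 'p mod_ring set)"
    using assms by (intro card_subset_eq) auto
  then show ?thesis by auto
qed

section \<open>Automorphisms supported below a vertex\<close>

fun at_vertex :: "'x list \<Rightarrow> ('x list \<Rightarrow> 'x list) \<Rightarrow> 'x list \<Rightarrow> 'x list" where
  "at_vertex [] h w = h w"
| "at_vertex (x # v) h [] = []"
| "at_vertex (x # v) h (y # w) = (if x = y then y # at_vertex v h w else y # w)"

lemma at_vertex_append: "at_vertex (u @ v) h w = at_vertex u (at_vertex v h) w"
  by (induction u "at_vertex v h" w rule: at_vertex.induct) auto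

lemma at_vertex_apply [simp]: "at_vertex v h (v @ w) = v @ h w"
  by (induction v) auto

lemma at_vertex_other: "(\<And>u. w \<noteq> v @ u) \<Longrightarrow> at_vertex v h w = w"
  by (induction v h w rule: at_vertex.induct) auto

lemma at_vertex_comp: "at_vertex v (g \<circ> h) w = at_vertex v g (at_vertex v h w)"
  by (induction v h w rule: at_vertex.induct) auto

lemma at_vertex_id [simp]: "at_vertex v id = id"
proof
  show "at_vertex v id w = id w" for w :: "'a list"
    by (induction v "id :: 'a list \<Rightarrow> _" w rule: at_vertex.induct) auto
qed

lemma inv_at_vertex:
  assumes "bij h"
  shows "inv (at_vertex v h) = at_vertex v (inv h)"
proof (rule inv_unique_comp)
  have "at_vertex v g (at_vertex v g' w) = w" if "g \<circ> g' = id" for g g' w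
    using at_vertex_comp[of v g g' w] by (simp add: that)
  moreover have "h \<circ> inv h = id" "inv h \<circ> h = id"
    using assms by (simp_all flip: surj_iff inj_iff add: bij_is_surj bij_is_inj)
  ultimately show "at_vertex v h \<circ> at_vertex v (inv h) = id" "at_vertex v (inv h) \<circ> at_vertex v h = id"
    by (simp_all add: fun_eq_iff)
qed

definition comm :: "('x \<Rightarrow> 'x) \<Rightarrow> ('x \<Rightarrow> 'x) \<Rightarrow> 'x \<Rightarrow> 'x" where
  "comm g h = g \<circ> h \<circ> inv g \<circ> inv h"

section \<open>Words in the generators and their sections\<close>

text \<open>\<open>deg_2\<close> is the form in which the exclusion of the infinite dihedral group
  is used.\<close>

locale sunic =
  fixes f :: "'p::prime_card mod_ring poly"
  assumes deg: "degree f \<ge> 1" and coeff_0: "coeff f 0 \<noteq> 0"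
    and deg_2: "CARD('p) = 2 \<Longrightarrow> degree f \<ge> 2"
begin

abbreviation V where "V \<equiv> carrier_vec (degree f) :: 'p mod_ring vec set"

lemma act_B_add: "y \<in> V \<Longrightarrow> z \<in> V \<Longrightarrow> act_B f y (act_B f z w) = act_B f (y + z) w"
  by (induction w arbitrary: y z) (auto simp: act_A_add omega_add[OF deg] rho_add)

lemma act_B_0 [simp]: "act_B f (0\<^sub>v (degree f)) w = w"
  by (induction w) (auto simp: omega_zero[OF deg] rho_zero)

lemma inv_act_B: "y \<in> V \<Longrightarrow> inv (act_B f y) = act_B f (- y)"
  by (rule inv_unique_comp) (auto simp: fun_eq_iff act_B_add)

lemma bij_act_B: "y \<in> V \<Longrightarrow> bij (act_B f y)"
  by (rule o_bij[of "act_B f (- y)"]) (auto simp: fun_eq_iff act_B_add)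

text \<open>A relation and not a function of \<open>g\<close>: the exponent sums belong to a word,
  and no claim is made that all words for one element share them.\<close>

inductive word_rep ::
    "('p mod_ring list \<Rightarrow> 'p mod_ring list) \<Rightarrow> 'p mod_ring \<Rightarrow> 'p mod_ring vec \<Rightarrow> bool" where
  word_id: "word_rep id 0 (0\<^sub>v (degree f))"
| word_A: "word_rep g t y \<Longrightarrow> word_rep (act_A k \<circ> g) (k + t) y"
| word_B: "word_rep g t y \<Longrightarrow> z \<in> V \<Longrightarrow> word_rep (act_B f z \<circ> g) t (z + y)"

definition G :: "('p mod_ring list \<Rightarrow> 'p mod_ring list) set" where
  "G = {g. \<exists>t y. word_rep g t y}"

lemma word_rep_carrier: "word_rep g t y \<Longrightarrow> y \<in> V"
  by (induction rule: word_rep.induct) auto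

lemma word_rep_act_A: "word_rep (act_A k) k (0\<^sub>v (degree f))"
  using word_A[OF word_id, of k] by simp

lemma word_rep_act_B: "z \<in> V \<Longrightarrow> word_rep (act_B f z) 0 z"
  using word_B[OF word_id, of z] by simp

lemma word_rep_comp:
  "word_rep g t y \<Longrightarrow> word_rep h s z \<Longrightarrow> word_rep (g \<circ> h) (t + s) (y + z)"
proof (induction rule: word_rep.induct)
  case word_id
  then show "word_rep (id \<circ> h) (0 + s) (0\<^sub>v (degree f) + z)"
    using word_rep_carrier[of h s z] by simp
next
  case (word_A g t y k)
  then show "word_rep (act_A k \<circ> g \<circ> h) (k + t + s) (y + z)"
    using word_rep.word_A[of "g \<circ> h" "t + s" "y + z" k] by (simp only: o_assoc add.assoc)
next
  case (word_B g t y u)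
  then show "word_rep (act_B f u \<circ> g \<circ> h) (t + s) (u + y + z)"
    using word_rep.word_B[of "g \<circ> h" "t + s" "y + z" u]
    by (simp only: o_assoc word_rep_carrier assoc_add_vec[of u "degree f" y z])
qed

lemma word_rep_inv:
  "word_rep g t y \<Longrightarrow> bij g \<and> word_rep (inv g) (- t) (- y)"
proof (induction rule: word_rep.induct)
  case word_id
  show "bij id \<and> word_rep (inv id) (- 0) (- 0\<^sub>v (degree f))"
    using word_rep.word_id by simp
next
  case (word_A g t y k)
  then have "bij g" "y \<in> V" by (auto intro: word_rep_carrier)
  then show "bij (act_A k \<circ> g) \<and> word_rep (inv (act_A k \<circ> g)) (- (k + t)) (- y)"
    using word_rep_comp[of "inv g" "- t" "- y" "act_A (- k)" "- k", OF _ word_rep_act_A] word_A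
    by (simp add: bij_act_A o_inv_distrib inv_act_A bij_comp add.commute)
next
  case (word_B g t y u)
  then have "bij g" and y: "y \<in> V" by (auto intro: word_rep_carrier)
  moreover have "- (u + y) = - y + - u"
    using word_B(2) y by auto
  ultimately show "bij (act_B f u \<circ> g) \<and> word_rep (inv (act_B f u \<circ> g)) (- t) (- (u + y))"
    using word_rep_comp[of "inv g" "- t" "- y" "act_B f (- u)" 0, OF _ word_rep_act_B] word_B
    by (simp add: bij_act_B o_inv_distrib inv_act_B bij_comp)
qed

lemma G_id [simp]: "id \<in> G"
  using word_id by (auto simp: G_def)

lemma G_comp: "g \<in> G \<Longrightarrow> h \<in> G \<Longrightarrow> g \<circ> h \<in> G"
  using word_rep_comp unfolding G_def by blast

lemma G_inv: "g \<in> G \<Longrightarrow> inv g \<in> G"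
  using word_rep_inv unfolding G_def by blast

lemma G_act_A [simp]: "act_A k \<in> G"
  using word_rep_act_A by (auto simp: G_def)

lemma G_act_B [simp]: "y \<in> V \<Longrightarrow> act_B f y \<in> G"
  using word_rep_act_B unfolding G_def by blast

lemma G_bij: "g \<in> G \<Longrightarrow> bij g"
  using word_rep_inv by (auto simp: G_def)

lemma G_inv_left [simp]: "g \<in> G \<Longrightarrow> inv g (g w) = w"
  using G_bij by (simp add: bij_is_inj)

lemma G_inv_right [simp]: "g \<in> G \<Longrightarrow> g (inv g w) = w"
  using G_bij by (simp add: bij_is_surj surj_f_inv_f)

lemma G_inv_comp: "g \<in> G \<Longrightarrow> h \<in> G \<Longrightarrow> inv (g \<circ> h) = inv h \<circ> inv g"
  by (simp add: G_bij o_inv_distrib)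

lemma G_inv_inv [simp]: "g \<in> G \<Longrightarrow> inv (inv g) = g"
  by (simp add: G_bij inv_inv_eq)

lemma G_induct [consumes 1, case_names id A B]:
  assumes "g \<in> G" and "P id"
    and "\<And>g k. g \<in> G \<Longrightarrow> P g \<Longrightarrow> P (act_A k \<circ> g)"
    and "\<And>g z. g \<in> G \<Longrightarrow> z \<in> V \<Longrightarrow> P g \<Longrightarrow> P (act_B f z \<circ> g)"
  shows "P g"
proof -
  have "P h" if "word_rep h t y" for h t y
    using that
  proof (induction rule: word_rep.induct)
    show "P id" by fact
    show "P (act_A k \<circ> g)" if "word_rep g t y" "P g" for g t y k
      using assms(3) that unfolding G_def by blast
    show "P (act_B f z \<circ> g)" if "word_rep g t y" "P g" "z \<in> V" for g t y z
      using assms(4) that unfolding G_def by blast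
  qed
  then show ?thesis using assms(1) by (auto simp: G_def)
qed

text \<open>A letter of \<open>B\<close> puts its \<open>omega\<close> image into one section and
  its \<open>rho\<close> image into another, while a letter of \<open>A\<close> on the left leaves
  the sections alone. Summing over all letters removes the dependence on where the images
  land.\<close>

lemma word_rep_sections:
  assumes "word_rep g t y"
  shows "\<exists>s ts ys. (\<forall>x. word_rep (s x) (ts x) (ys x)) \<and> (\<forall>x w. g (x # w) = (x + t) # s x w)
    \<and> (\<Sum>x\<in>UNIV. ts x) = omega f y \<and> (\<forall>j<degree f. (\<Sum>x\<in>UNIV. ys x $ j) = rho f y $ j)"
  using assms
proof (induction rule: word_rep.induct)
  case word_id
  have "word_rep id 0 (0\<^sub>v (degree f))" by (fact word_rep.word_id)
  then show ?case
    by (intro exI[of _ "\<lambda>_. id"] exI[of _ "\<lambda>_. 0"] exI[of _ "\<lambda>_. 0\<^sub>v (degree f)"])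
      (simp add: omega_zero[OF deg] rho_zero id_def)
next
  case (word_A g t y k)
  then obtain s ts ys where "\<forall>x. word_rep (s x) (ts x) (ys x)"
    "\<forall>x w. g (x # w) = (x + t) # s x w"
    "(\<Sum>x\<in>UNIV. ts x) = omega f y" "\<forall>j<degree f. (\<Sum>x\<in>UNIV. ys x $ j) = rho f y $ j"
    by blast
  then show ?case
    by (intro exI[of _ s] exI[of _ ts] exI[of _ ys]) (auto simp: algebra_simps)
next
  case (word_B g t y z)
  then obtain s ts ys where s: "\<And>x. word_rep (s x) (ts x) (ys x)"
    "\<And>x w. g (x # w) = (x + t) # s x w"
    "(\<Sum>x\<in>UNIV. ts x) = omega f y" "\<And>j. j<degree f \<Longrightarrow> (\<Sum>x\<in>UNIV. ys x $ j) = rho f y $ j"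
    by blast
  have y: "y \<in> V" and ys: "ys x \<in> V" for x
    using word_B s(1) word_rep_carrier by auto
  \<comment> \<open>The new letter is applied after \<open>g\<close>, which has moved
    \<open>x\<close> to \<open>x + t\<close>.\<close>
  define s' where "s' x = (if x + t = 0 then act_A (omega f z) \<circ> s x
      else if x + t = - 1 then act_B f (rho f z) \<circ> s x else s x)" for x
  define ts' where "ts' x = (if x + t = 0 then omega f z + ts x else ts x)" for x
  define ys' where "ys' x = (if x + t = - 1 then rho f z + ys x else ys x)" for x
  have "word_rep (s' x) (ts' x) (ys' x)" for x
    using s(1)[of x] by (auto simp: s'_def ts'_def ys'_def intro: word_rep.word_A word_rep.word_B)
  moreover have "(act_B f z \<circ> g) (x # w) = (x + t) # s' x w" for x w
    by (auto simp: s(2) s'_def)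
  moreover have "(\<Sum>x\<in>UNIV. ts' x) = omega f (z + y)"
  proof -
    have "ts' x = ts x + (if x = - t then omega f z else 0)" for x
      by (auto simp: ts'_def eq_neg_iff_add_eq_0)
    then show ?thesis
      using y word_B.hyps s(3) by (simp add: sum.distrib omega_add[OF deg] add.commute)
  qed
  moreover have "(\<Sum>x\<in>UNIV. ys' x $ j) = rho f (z + y) $ j" if j: "j < degree f" for j
  proof -
    have "ys' x $ j = ys x $ j + (if x = - 1 - t then rho f z $ j else 0)" for x
      using j ys[of x] by (auto simp: ys'_def eq_diff_eq)
    then show ?thesis
      using y word_B.hyps s(4)[OF j] j by (simp add: sum.distrib rho_add add.commute)
  qed
  ultimately show ?case by blast
qed

lemma G_first_level:
  assumes "g \<in> G"
  shows "\<exists>t s. \<forall>x. s x \<in> G \<and> (\<forall>w. g (x # w) = (x + t) # s x w)"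
proof -
  obtain t y where "word_rep g t y" using assms by (auto simp: G_def)
  then show ?thesis using word_rep_sections[of g t y] unfolding G_def by fast
qed

lemma G_length [simp]: "g \<in> G \<Longrightarrow> length (g w) = length w"
proof (induction w arbitrary: g)
  case Nil
  then obtain t y where "word_rep g t y" unfolding G_def by blast
  then have "g [] = []" by (induction rule: word_rep.induct) auto
  then show ?case by simp
next
  case (Cons x w)
  then show ?case using G_first_level[OF Cons.prems] by fastforce
qed

lemma G_Nil [simp]: "g \<in> G \<Longrightarrow> g [] = []"
  by (metis G_length length_0_conv)

section \<open>Sections at vertices, fractality and level transitivity\<close>

definition vsection ::
    "('p mod_ring list \<Rightarrow> 'p mod_ring list) \<Rightarrow> 'p mod_ring list \<Rightarrow> 'p mod_ring list \<Rightarrow> 'p mod_ring list"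
  where "vsection g v w = drop (length v) (g (v @ w))"

lemma vsection_eqI: "g \<in> G \<Longrightarrow> (\<And>w. g (v @ w) = v' @ h w) \<Longrightarrow> length v' = length v \<Longrightarrow> vsection g v = h"
  by (auto simp: vsection_def fun_eq_iff)

lemma G_vsection:
  assumes "g \<in> G"
  shows "vsection g v \<in> G" "g (v @ w) = g v @ vsection g v w"
proof -
  have "\<exists>h\<in>G. \<forall>w. g (v @ w) = g v @ h w"
    using assms
  proof (induction v arbitrary: g)
    case (Cons x v)
    obtain t s where s: "\<And>x. s x \<in> G" "\<And>x w. g (x # w) = (x + t) # s x w"
      using G_first_level[OF Cons.prems] by blast
    then show ?case using Cons.IH[OF s(1)[of x]] by auto
  qed auto
  then obtain h where h: "h \<in> G" "\<And>w. g (v @ w) = g v @ h w" by blast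
  then have "vsection g v = h" using assms by (intro vsection_eqI[of g v "g v"]) auto
  then show "vsection g v \<in> G" "g (v @ w) = g v @ vsection g v w" using h by auto
qed

text \<open>On one level, \<open>act_B f y\<close> has section \<open>act_A (omega f y)\<close> at
  0, its conjugate by \<open>act_A 1\<close> has section \<open>act_B f (rho f y)\<close> there, and
  \<open>omega\<close> and \<open>rho\<close> are onto.\<close>

lemma fractal: "h \<in> G \<Longrightarrow> \<exists>g\<in>G. \<forall>w. g (replicate n 0 @ w) = replicate n 0 @ h w"
proof (induction n)
  case (Suc n)
  have one: "\<exists>g\<in>G. \<forall>w. g (0 # w) = 0 # h w" if "h \<in> G" for h
    using that
  proof (induction rule: G_induct)
    case id
    then show ?case by (intro bexI[of _ id]) auto
  next
    case (A h k)
    then obtain g where g: "g \<in> G" "\<And>w. g (0 # w) = 0 # h w" by blast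
    define y where "y = vec (degree f) (\<lambda>_. k)"
    have "y \<in> V" "omega f y = k" using deg by (auto simp: y_def omega_def)
    then show ?case using g by (intro bexI[of _ "act_B f y \<circ> g"]) (auto intro: G_comp)
  next
    case (B h z)
    then obtain g where g: "g \<in> G" "\<And>w. g (0 # w) = 0 # h w" by blast
    obtain y where y: "y \<in> V" "rho f y = z" using rho_surj[OF deg coeff_0 B(2)] by blast
    show ?case
      using g y by (intro bexI[of _ "act_A 1 \<circ> (act_B f y \<circ> (act_A (- 1) \<circ> g))"]) (auto intro!: G_comp)
  qed
  obtain g where g: "g \<in> G" "\<And>w. g (replicate n 0 @ w) = replicate n 0 @ h w"
    using Suc by blast
  then show ?case using one[OF g(1)] by (metis append_Cons replicate_Suc)
next
  case 0
  then show ?case by (intro bexI[of _ h]) auto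
qed

lemma level_transitive: "\<exists>g\<in>G. g v = replicate (length v) 0"
proof (induction v)
  case (Cons x v)
  then obtain g where g: "g \<in> G" "g v = replicate (length v) 0" by blast
  obtain h where h: "h \<in> G" "\<And>w. h (0 # w) = 0 # g w" using fractal[OF g(1), of 1] by auto
  show ?case
    using g h by (intro bexI[of _ "h \<circ> act_A (- x)"]) (auto intro: G_comp)
next
  case Nil
  then show ?case by (intro bexI[of _ id]) auto
qed

lemma conj_at_vertex:
  assumes g: "g \<in> G"
  shows "g \<circ> at_vertex v k \<circ> inv g = at_vertex (g v) (vsection g v \<circ> k \<circ> inv (vsection g v))"
proof
  fix w
  let ?s = "vsection g v"
  define u where "u = inv g w"
  have w: "w = g u" using g by (simp add: u_def)
  have "g (at_vertex v k u) = at_vertex (g v) (?s \<circ> k \<circ> inv ?s) (g u)"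
  proof (cases "\<exists>u'. u = v @ u'")
    case True
    then show ?thesis using g by (auto simp: G_vsection)
  next
    case False
    \<comment> \<open>\<open>g\<close> maps the words below \<open>v\<close> onto those below
      \<open>g v\<close>, so words outside stay outside, where both copies do nothing.\<close>
    have "g u \<noteq> g v @ u'" for u'
    proof
      assume "g u = g v @ u'"
      also have "\<dots> = g (v @ inv ?s u')" using g by (simp add: G_vsection)
      finally have "u = v @ inv ?s u'" using G_bij[OF g] by (simp add: bij_is_inj inj_eq)
      with False show False by blast
    qed
    then show ?thesis using False by (simp add: at_vertex_other)
  qed
  then show "(g \<circ> at_vertex v k \<circ> inv g) w = at_vertex (g v) (?s \<circ> k \<circ> inv ?s) w"
    using g by (simp add: w)
qed

section \<open>The branching subgroup\<close>

text \<open>The group is treated as a concrete set of maps under composition; the translation to the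
  abstract group comes at the end.\<close>

definition normal_sub :: "('p mod_ring list \<Rightarrow> 'p mod_ring list) set \<Rightarrow> bool" where
  "normal_sub N \<longleftrightarrow> N \<subseteq> G \<and> id \<in> N \<and> (\<forall>g\<in>N. \<forall>h\<in>N. g \<circ> h \<in> N) \<and> (\<forall>g\<in>N. inv g \<in> N)
    \<and> (\<forall>g\<in>G. \<forall>h\<in>N. g \<circ> h \<circ> inv g \<in> N)"

lemma normal_subD:
  assumes "normal_sub N"
  shows "g \<in> N \<Longrightarrow> g \<in> G" "id \<in> N" "g \<in> N \<Longrightarrow> h \<in> N \<Longrightarrow> g \<circ> h \<in> N" "g \<in> N \<Longrightarrow> inv g \<in> N"
    "g \<in> G \<Longrightarrow> h \<in> N \<Longrightarrow> g \<circ> h \<circ> inv g \<in> N"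
  using assms unfolding normal_sub_def by auto

lemma normal_sub_G: "normal_sub G"
  by (auto simp: normal_sub_def G_comp G_inv)

lemma comm_in_G: "g \<in> G \<Longrightarrow> h \<in> G \<Longrightarrow> comm g h \<in> G"
  by (simp add: comm_def G_comp G_inv)

lemma inv_comm: "g \<in> G \<Longrightarrow> h \<in> G \<Longrightarrow> inv (comm g h) = comm h g"
  by (simp add: comm_def G_inv_comp G_comp G_inv o_assoc)

lemma normal_sub_comm: "normal_sub N \<Longrightarrow> k \<in> N \<Longrightarrow> g \<in> G \<Longrightarrow> comm k g \<in> N"
  using normal_subD(3)[of N k "g \<circ> inv k \<circ> inv g"] normal_subD(4,5)[of N] by (simp add: comm_def o_assoc)

lemma normal_sub_eq_G:
  assumes N: "normal_sub N" and A: "\<And>k. act_A k \<in> N" and B: "\<And>y. y \<in> V \<Longrightarrow> act_B f y \<in> N"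
  shows "N = G"
proof -
  have "g \<in> N" if "g \<in> G" for g
    using that
  proof (induction rule: G_induct)
    show "id \<in> N" by (rule normal_subD(2)[OF N])
    show "act_A k \<circ> g \<in> N" if "g \<in> N" for g k by (rule normal_subD(3)[OF N A that])
    show "act_B f z \<circ> g \<in> N" if "z \<in> V" "g \<in> N" for g z by (rule normal_subD(3)[OF N B[OF that(1)] that(2)])
  qed
  then show ?thesis using normal_subD(1)[OF N] by auto
qed

text \<open>For odd \<open>p\<close> the space \<open>B0\<close> is all of \<open>V\<close>, and \<open>K\<close> below is the commutator subgroup.\<close>

definition B0 :: "'p mod_ring vec set" where
  "B0 = {y \<in> V. CARD('p) = 2 \<longrightarrow> omega f y = 0}"

definition K :: "('p mod_ring list \<Rightarrow> 'p mod_ring list) set" where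
  "K = \<Inter>{N. normal_sub N \<and> (\<forall>t. \<forall>y\<in>B0. comm (act_A t) (act_B f (rho f y)) \<in> N)}"

lemma B0_V: "y \<in> B0 \<Longrightarrow> y \<in> V"
  by (simp add: B0_def)

text \<open>The induction principle of \<open>K\<close>: a property of all its elements follows once
  the elements with the property form a normal subgroup containing the generators.\<close>

lemma K_least:
  assumes "normal_sub N" "\<And>t y. y \<in> B0 \<Longrightarrow> comm (act_A t) (act_B f (rho f y)) \<in> N"
  shows "K \<subseteq> N"
  using assms unfolding K_def by blast

lemma K_comm: "y \<in> B0 \<Longrightarrow> comm (act_A t) (act_B f (rho f y)) \<in> K"
  unfolding K_def by blast

lemma normal_sub_K: "normal_sub K"
proof -
  have "K \<subseteq> G" by (rule K_least[OF normal_sub_G]) (simp add: comm_in_G)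
  then show ?thesis unfolding normal_sub_def by (auto simp: K_def normal_subD)
qed

text \<open>The infinite dihedral group has to be excluded here: for p = 2 and degree 1 the space
  \<open>B0\<close> is zero.\<close>

lemma exists_B0_omega: "\<exists>y\<in>B0. omega f (rho f y) = t"
proof (cases "CARD('p) = 2")
  case True
  let ?m = "degree f"
  \<comment> \<open>\<open>rho\<close> shifts this position to the last one, which
    \<open>omega\<close> reads; the last coordinate of \<open>y\<close> itself is 0, as
    \<open>B0\<close> requires.\<close>
  define y where "y = vec ?m (\<lambda>i. if i = ?m - 2 then t else 0)"
  have m: "?m \<ge> 2" using deg_2 True by blast
  have y: "y \<in> V" by (simp add: y_def)
  have "omega f y = 0" "omega f (rho f y) = t"
    using m rho_index[OF y, of "?m - 1"] by (auto simp: omega_def y_def)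
  then show ?thesis using y by (auto simp: B0_def)
next
  case False
  let ?z = "vec (degree f) (\<lambda>_. t)"
  obtain y where "y \<in> V" "rho f y = ?z" using rho_surj[OF deg coeff_0, of ?z] by auto
  then show ?thesis using deg False by (intro bexI[of _ y]) (auto simp: B0_def omega_def)
qed

text \<open>On the first level \<open>act_B f z\<close> can act nontrivially below 0 and -1, the
  conjugate of \<open>act_B f y\<close> below 0 and 1. For odd p these meet only at 0. For p = 2
  they also meet at 1 = -1, where the conjugate has section \<open>act_A (omega f y)\<close>,
  trivial because \<open>y\<close> lies in \<open>B0\<close>.\<close>

lemma comm_act_B_conj:
  assumes z: "z \<in> V" and y: "y \<in> B0"
  shows "comm (act_B f z) (act_A 1 \<circ> act_B f y \<circ> act_A (- 1))
    = at_vertex [0] (comm (act_A (omega f z)) (act_B f (rho f y)))"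
proof -
  have yV: "y \<in> V" using y by (rule B0_V)
  have inv: "inv (act_A 1 \<circ> act_B f y \<circ> act_A (- 1)) = act_A 1 \<circ> act_B f (- y) \<circ> act_A (- 1)"
    using yV by (simp add: G_inv_comp G_comp inv_act_A inv_act_B o_assoc)
  have two: "CARD('p) = 2" if "(1 :: 'p mod_ring) = - 1"
    using that mod_ring_minus_one_neq_one[where 'p='p] by metis
  have om: "omega f y = 0" "omega f (- y) = 0" if "(1 :: 'p mod_ring) = - 1"
    using y two[OF that] by (auto simp: B0_def omega_uminus[OF deg])
  have cases: "x = 0 \<or> x = 1 \<or> x \<noteq> 0 \<and> x \<noteq> 1 \<and> x - 1 \<noteq> 0 \<and> x - 1 \<noteq> - 1" for x :: "'p mod_ring"
    by auto
  have vec: "rho f z + - rho f z = 0\<^sub>v (degree f)"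
    "rho f z + (rho f y + (- rho f z + - rho f y)) = 0\<^sub>v (degree f)"
    by (auto intro!: eq_vecI)
  show ?thesis
  proof
    fix w
    show "comm (act_B f z) (act_A 1 \<circ> act_B f y \<circ> act_A (- 1)) w
      = at_vertex [0] (comm (act_A (omega f z)) (act_B f (rho f y))) w"
    proof (cases w)
      case (Cons x v)
      from cases[of x] show ?thesis
        unfolding Cons comm_def inv
        using z yV om
        by (auto simp: inv_act_A inv_act_B omega_uminus[OF deg] rho_uminus act_A_add act_B_add vec)
    qed (use z yV in \<open>simp add: comm_def inv inv_act_A inv_act_B\<close>)
  qed
qed

lemma lift_zeros:
  assumes "h \<in> G"
  obtains g where "g \<in> G" "\<And>w. g (replicate n 0 @ w) = replicate n 0 @ h w"
    "g (replicate n 0) = replicate n 0" "vsection g (replicate n 0) = h"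
proof -
  obtain g where g: "g \<in> G" "\<And>w. g (replicate n 0 @ w) = replicate n 0 @ h w"
    using fractal[OF assms] by blast
  moreover have "g (replicate n 0) = replicate n 0" using g(2)[of "[]"] assms by simp
  moreover have "vsection g (replicate n 0) = h" using g by (intro vsection_eqI) auto
  ultimately show ?thesis by (rule that)
qed

text \<open>
  Since \<open>act_B f z\<close> commutes with \<open>act_B f y\<close>, the commutator of \<open>act_B f z\<close> with the conjugate of
  \<open>act_B f y\<close> by \<open>act_A 1\<close> is also the commutator of \<open>comm (act_B f z) (act_A 1)\<close>, an element of \<open>K\<close>,
  with that conjugate. This turns commutators with \<open>K\<close> into copies of generators of \<open>K\<close> one level below.
\<close>

lemma K_at_Suc:
  assumes N: "normal_sub N"
    and comm_N: "\<And>k g. k \<in> K \<Longrightarrow> g \<in> G \<Longrightarrow> at_vertex (replicate n 0) (comm k g) \<in> N"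
    and "k \<in> K"
  shows "at_vertex (replicate (Suc n) 0) k \<in> N"
proof -
  let ?v = "replicate (Suc n) 0 :: 'p mod_ring list"
  \<comment> \<open>Normality of this set comes from fractality: each element of \<open>G\<close> is
    the section at \<open>?v\<close> of an element fixing \<open>?v\<close>.\<close>
  let ?M = "{h \<in> G. at_vertex ?v h \<in> N}"
  have "K \<subseteq> ?M"
  proof (rule K_least)
    have "at_vertex ?v (g \<circ> h \<circ> inv g) \<in> N" if "g \<in> G" "h \<in> ?M" for g h
    proof -
      obtain g' where "g' \<in> G" "g' ?v = ?v" "vsection g' ?v = g"
        by (rule lift_zeros[OF \<open>g \<in> G\<close>, of "Suc n"])
      then show ?thesis using conj_at_vertex[of g' ?v h] normal_subD(5)[OF N, of g' "at_vertex ?v h"] that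
        by (simp del: replicate.simps)
    qed
    moreover have "at_vertex ?v (g \<circ> h) = at_vertex ?v g \<circ> at_vertex ?v h" for g h
      by (simp del: replicate.simps add: fun_eq_iff at_vertex_comp)
    ultimately show "normal_sub ?M"
      unfolding normal_sub_def
      by (auto simp del: replicate.simps simp: G_comp G_inv normal_subD(2,3)[OF N])
        (metis G_bij inv_at_vertex normal_subD(4)[OF N])
  next
    fix t y assume y: "y \<in> B0"
    \<comment> \<open>With \<open>z\<close> in the image of \<open>B0\<close> under
      \<open>rho\<close>, the commutator \<open>?k\<close> lies in \<open>K\<close>; the condition
      on \<open>omega\<close> produces the factor \<open>act_A t\<close> one level below.\<close>
    obtain z' where z': "z' \<in> B0" "omega f (rho f z') = t" using exists_B0_omega by blast
    define z where "z = rho f z'"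
    have z: "z \<in> V" by (simp add: z_def)
    let ?k = "comm (act_B f z) (act_A 1)" and ?g = "act_A 1 \<circ> act_B f y \<circ> act_A (- 1)"
    have k: "?k \<in> K"
      using normal_subD(4)[OF normal_sub_K K_comm[OF z'(1), of 1]] inv_comm[of "act_A 1" "act_B f z"] z
      by (simp add: z_def)
    have yV: "y \<in> V" using y by (rule B0_V)
    have g: "?g \<in> G" using yV by (simp add: G_comp)
    have "comm ?k ?g = comm (act_B f z) ?g"
    proof -
      have inv: "inv ?g = act_A 1 \<circ> act_B f (- y) \<circ> act_A (- 1)"
        using yV by (simp add: G_inv_comp G_comp inv_act_A inv_act_B o_assoc)
      have "inv ?k = act_A 1 \<circ> act_B f z \<circ> act_A (- 1) \<circ> act_B f (- z)"
        using z inv_comm[of "act_B f z" "act_A 1"] by (simp add: comm_def inv_act_A inv_act_B)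
      moreover have "- z + (y + z) = y" "z + - z = 0\<^sub>v (degree f)"
        using yV z by (auto intro!: eq_vecI)
      ultimately show ?thesis
        using yV z by (simp add: fun_eq_iff comm_def inv inv_act_A inv_act_B act_A_add act_B_add)
    qed
    also have "\<dots> = at_vertex [0] (comm (act_A t) (act_B f (rho f y)))"
      using comm_act_B_conj[OF z y] z'(2) by (simp add: z_def)
    finally have e: "comm ?k ?g = at_vertex [0] (comm (act_A t) (act_B f (rho f y)))" .
    have "at_vertex ?v h = at_vertex (replicate n 0) (at_vertex [0] h)" for h
    proof -
      have "?v = replicate n 0 @ [0]" by (simp add: replicate_append_same)
      then show ?thesis by (simp only: fun_eq_iff at_vertex_append simp_thms)
    qed
    then have "at_vertex ?v (comm (act_A t) (act_B f (rho f y))) = at_vertex (replicate n 0) (comm ?k ?g)"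
      by (simp only: e)
    then show "comm (act_A t) (act_B f (rho f y)) \<in> ?M"
      using comm_N[OF k g] by (simp del: replicate.simps add: comm_in_G)
  qed
  then show ?thesis using assms(3) by blast
qed

text \<open>The branching property. By normality \<open>comm k g\<close> lies in \<open>K\<close>,
  so the induction hypothesis supplies its copies, and these yield the copies of \<open>K\<close>
  one level further down.\<close>

lemma K_at_zeros: "k \<in> K \<Longrightarrow> at_vertex (replicate n 0) k \<in> K"
proof (induction n arbitrary: k)
  case (Suc n)
  show ?case
    by (rule K_at_Suc[OF normal_sub_K _ Suc.prems]) (intro Suc.IH normal_sub_comm[OF normal_sub_K])
next
  case 0
  have "at_vertex [] k = k" by (simp add: fun_eq_iff)
  then show ?case using 0 by simp
qed

section \<open>Sections of elements of the branching subgroup\<close>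

lemma comm_act_section:
  assumes y: "y \<in> V"
  shows "comm (act_A 1) (act_B f y) (0 # w) = 0 # (act_B f (rho f y) \<circ> act_A (- omega f y)) w"
  \<comment> \<open>The inverse of \<open>act_B f y\<close> reads the letter 0 and leaves
    \<open>act_A (- omega f y)\<close>; after the rotation \<open>act_B f y\<close> reads -1 and
    leaves \<open>act_B f (rho f y)\<close>.\<close>
  using y by (simp add: comm_def inv_act_A inv_act_B omega_uminus[OF deg])

definition sections :: "nat \<Rightarrow> ('p mod_ring list \<Rightarrow> 'p mod_ring list) set
    \<Rightarrow> ('p mod_ring list \<Rightarrow> 'p mod_ring list) set" where
  "sections n N = {h. \<exists>g\<in>N. \<forall>w. g (replicate n 0 @ w) = replicate n 0 @ h w}"

lemma sections_add: "sections n (sections m N) \<subseteq> sections (m + n) N"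
proof
  fix h assume "h \<in> sections n (sections m N)"
  then obtain g g' where "g \<in> N" "\<And>w. g (replicate m 0 @ w) = replicate m 0 @ g' w"
    "\<And>w. g' (replicate n 0 @ w) = replicate n 0 @ h w"
    unfolding sections_def by blast
  then show "h \<in> sections (m + n) N"
    unfolding sections_def by (intro CollectI bexI[of _ g]) (simp_all add: replicate_add)
qed

text \<open>Closure under conjugation is the point: by fractality the conjugating element is itself
  a section of an element fixing the vertex.\<close>

lemma normal_sub_sections:
  assumes N: "normal_sub N"
  shows "normal_sub (sections n N)"
proof -
  let ?v = "replicate n 0 :: 'p mod_ring list"
  have G: "h \<in> G" if "h \<in> sections n N" for h
  proof -
    from that obtain g where g: "g \<in> N" "\<And>w. g (?v @ w) = ?v @ h w" by (auto simp: sections_def)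
    then have "vsection g ?v = h" using normal_subD(1)[OF N] by (intro vsection_eqI) auto
    then show ?thesis using g normal_subD(1)[OF N] G_vsection(1) by blast
  qed
  have "id \<in> sections n N" using normal_subD(2)[OF N] unfolding sections_def
    by (intro CollectI bexI[of _ id]) auto
  moreover have "h \<circ> h' \<in> sections n N" if "h \<in> sections n N" "h' \<in> sections n N" for h h'
  proof -
    from that obtain g g' where "g \<in> N" "\<forall>w. g (?v @ w) = ?v @ h w" "g' \<in> N" "\<forall>w. g' (?v @ w) = ?v @ h' w"
      by (auto simp: sections_def)
    then show ?thesis unfolding sections_def using normal_subD(3)[OF N, of g g']
      by (intro CollectI bexI[of _ "g \<circ> g'"]) auto
  qed
  moreover have inv: "inv g (?v @ w) = ?v @ inv h w" if "g \<in> G" "h \<in> G" "\<And>w. g (?v @ w) = ?v @ h w" for g h w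
    using that by (metis G_inv_left G_inv_right)
  have "inv h \<in> sections n N" if h: "h \<in> sections n N" for h
  proof -
    from h obtain g where g: "g \<in> N" "\<And>w. g (?v @ w) = ?v @ h w" by (auto simp: sections_def)
    then show ?thesis unfolding sections_def using normal_subD(1,4)[OF N, of g] G[OF h]
      by (intro CollectI bexI[of _ "inv g"]) (auto simp: inv)
  qed
  moreover have "g \<circ> h \<circ> inv g \<in> sections n N" if g: "g \<in> G" and h: "h \<in> sections n N" for g h
  proof -
    from h obtain h' where h': "h' \<in> N" "\<And>w. h' (?v @ w) = ?v @ h w" by (auto simp: sections_def)
    obtain g' where g': "g' \<in> G" "\<And>w. g' (?v @ w) = ?v @ g w" using fractal[OF g] by blast
    show ?thesis unfolding sections_def using normal_subD(5)[OF N g'(1) h'(1)] g g' h'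
      by (intro CollectI bexI[of _ "g' \<circ> h' \<circ> inv g'"]) (auto simp: inv)
  qed
  ultimately show ?thesis using G by (auto simp: normal_sub_def)
qed

lemma sections_comm:
  assumes "comm (act_A 1) (act_B f y) \<in> N" "y \<in> V"
  shows "act_B f (rho f y) \<circ> act_A (- omega f y) \<in> sections 1 N"
  unfolding sections_def using assms comm_act_section[of y]
  by (intro CollectI bexI[of _ "comm (act_A 1) (act_B f y)"]) auto

text \<open>Modulo \<open>N\<close> the rotation \<open>act_A 1\<close> equals
  \<open>act_B f z\<close>, which commutes with all of \<open>B\<close>. In the computation
  \<open>?g\<close> is the inverse of \<open>?u\<close>.\<close>

lemma normal_sub_comm_act:
  assumes N: "normal_sub N" and u: "act_B f z \<circ> act_A (- 1) \<in> N" and z: "z \<in> V" and y: "y \<in> V"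
  shows "comm (act_A 1) (act_B f y) \<in> N"
proof -
  let ?u = "act_B f z \<circ> act_A (- 1)" and ?g = "act_A 1 \<circ> act_B f (- z)"
  have "inv (comm ?u (act_B f y)) \<in> N"
    using normal_subD(4)[OF N normal_sub_comm[OF N u]] y by simp
  then have "?g \<circ> inv (comm ?u (act_B f y)) \<circ> inv ?g \<in> N"
    using z by (intro normal_subD(5)[OF N]) (auto simp: G_comp)
  also have "?g \<circ> inv (comm ?u (act_B f y)) \<circ> inv ?g = comm (act_A 1) (act_B f y)"
  proof -
    have "inv ?u = act_A 1 \<circ> act_B f (- z)" "inv ?g = act_B f z \<circ> act_A (- 1)"
      using z by (simp_all add: G_inv_comp inv_act_A inv_act_B)
    moreover have "inv (comm ?u (act_B f y)) = comm (act_B f y) ?u"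
      using z y by (simp add: inv_comm G_comp)
    moreover have "- z + (y + z) = y" "- z + z = 0\<^sub>v (degree f)"
      using y z by (auto intro!: eq_vecI)
    ultimately show ?thesis
      using y z by (simp add: fun_eq_iff comm_def inv_act_A inv_act_B act_A_add act_B_add)
  qed
  finally show ?thesis .
qed

text \<open>Sections of commutators are products of an element of \<open>B\<close> and a rotation,
  and the two factors have to be separated. One level is enough for odd p; for p = 2 three levels
  are used.\<close>

lemma K_sections: "\<exists>n. sections n K = G"
proof (cases "CARD('p) = 2")
  case False
  let ?S = "sections 1 K"
  have S: "normal_sub ?S" by (rule normal_sub_sections[OF normal_sub_K])
  have *: "comm (act_A 1) (act_B f y) \<in> K" if y: "y \<in> V" for y
  proof -
    obtain u where "u \<in> V" "rho f u = y" using rho_surj[OF deg coeff_0 y] by blast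
    then show ?thesis using K_comm[of u 1] False by (auto simp: B0_def)
  qed
  have om: "act_A (omega f y) \<in> ?S" if y: "y \<in> V" for y
  proof -
    \<comment> \<open>The section of the commutator at the letter 1 is brought to 0. As 1 differs
      from -1, only the rotation by \<open>omega f y\<close> occurs there.\<close>
    let ?g = "act_A (- 1) \<circ> comm (act_A 1) (act_B f y) \<circ> inv (act_A (- 1))"
    have "?g \<in> K" by (rule normal_subD(5)[OF normal_sub_K _ *[OF y]]) simp
    moreover have "?g (0 # w) = 0 # act_A (omega f y) w" for w
      using y mod_ring_minus_one_neq_one[OF False] by (auto simp: comm_def inv_act_A inv_act_B)
    ultimately show ?thesis unfolding sections_def by (intro CollectI bexI[of _ ?g]) simp_all
  qed
  have A: "act_A k \<in> ?S" for k
    using om[of "vec (degree f) (\<lambda>_. k)"] deg by (simp add: omega_def)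
  have B: "act_B f y \<in> ?S" if y: "y \<in> V" for y
  proof -
    obtain u where u: "u \<in> V" "rho f u = y" using rho_surj[OF deg coeff_0 y] by blast
    have "act_B f y \<circ> act_A (- omega f u) \<circ> act_A (omega f u) \<in> ?S"
      using normal_subD(3)[OF S sections_comm[OF *[OF u(1)] u(1)] A] by (simp add: u(2))
    also have "act_B f y \<circ> act_A (- omega f u) \<circ> act_A (omega f u) = act_B f y"
      by (simp add: fun_eq_iff act_A_add)
    finally show ?thesis .
  qed
  show ?thesis using normal_sub_eq_G[OF S A B] by blast
next
  case True
  define S1 where "S1 = sections 1 K"
  define S2 where "S2 = sections 1 S1"
  define S3 where "S3 = sections 1 S2"
  have S: "normal_sub S1" "normal_sub S2" "normal_sub S3"
    by (simp_all add: S1_def S2_def S3_def normal_sub_sections normal_sub_K)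
  \<comment> \<open>The value 1 makes \<open>act_A 1\<close> congruent to an element of
    \<open>B\<close> modulo \<open>S1\<close>. So \<open>S1\<close> contains the commutators with
    all of \<open>B\<close>, not only with the image of \<open>B0\<close> under
    \<open>rho\<close>.\<close>
  obtain y1 where y1: "y1 \<in> B0" "omega f (rho f y1) = 1" using exists_B0_omega by blast
  have u1: "act_B f (rho f (rho f y1)) \<circ> act_A (- 1) \<in> S1"
    using sections_comm[OF K_comm[OF y1(1)]] y1(2) by (simp add: S1_def)
  have comm1: "comm (act_A 1) (act_B f y) \<in> S1" if "y \<in> V" for y
    by (rule normal_sub_comm_act[OF S(1) u1 rho_closed that])
  have S2: "act_B f (rho f y) \<circ> act_A (- omega f y) \<in> S2" if "y \<in> V" for y
    unfolding S2_def by (rule sections_comm[OF comm1[OF that] that])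
  let ?z = "vec (degree f) (\<lambda>_. 1) :: 'p mod_ring vec"
  have u2: "act_B f (rho f ?z) \<circ> act_A (- 1) \<in> S2"
    using S2[of ?z] deg by (simp add: omega_def)
  have comm2: "comm (act_A 1) (act_B f y) \<in> S2" if "y \<in> V" for y
    by (rule normal_sub_comm_act[OF S(2) u2 rho_closed that])
  have S3: "act_B f (rho f y) \<circ> act_A (- omega f y) \<in> S3" if "y \<in> V" for y
    unfolding S3_def by (rule sections_comm[OF comm2[OF that] that])
  \<comment> \<open>For \<open>y\<close> in \<open>B0\<close> the rotation factor is trivial, so
    \<open>act_B f (rho f y)\<close> itself lies in \<open>S2\<close>; its section at 0 is a pure
    rotation.\<close>
  have A: "act_A k \<in> S3" for k
  proof -
    obtain y where y: "y \<in> B0" "omega f (rho f y) = k" using exists_B0_omega by blast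
    have "omega f y = 0" using y(1) True by (simp add: B0_def)
    then have "act_B f (rho f y) \<in> S2"
      using S2[OF B0_V[OF y(1)]] by (simp add: comp_def)
    then show ?thesis unfolding S3_def sections_def
      using y(2) by (intro CollectI bexI[of _ "act_B f (rho f y)"]) simp_all
  qed
  have B: "act_B f y \<in> S3" if y: "y \<in> V" for y
  proof -
    obtain u where u: "u \<in> V" "rho f u = y" using rho_surj[OF deg coeff_0 y] by blast
    have "act_B f y \<circ> act_A (- omega f u) \<circ> act_A (omega f u) \<in> S3"
      using normal_subD(3)[OF S(3) S3[OF u(1)] A] by (simp add: u(2))
    also have "act_B f y \<circ> act_A (- omega f u) \<circ> act_A (omega f u) = act_B f y"
      by (simp add: fun_eq_iff act_A_add)
    finally show ?thesis .
  qed
  have S3_G: "S3 = G" by (rule normal_sub_eq_G[OF S(3) A B])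
  have "sections 1 (sections 1 (sections 1 K)) \<subseteq> sections (1 + 1) (sections 1 K)"
    by (rule sections_add)
  also have "\<dots> \<subseteq> sections (1 + (1 + 1)) K" by (rule sections_add)
  finally have "G \<subseteq> sections (1 + (1 + 1)) K" using S3_G unfolding S1_def S2_def S3_def by simp
  then have "sections (1 + (1 + 1)) K = G"
    using normal_subD(1)[OF normal_sub_sections[OF normal_sub_K]] by blast
  then show ?thesis by blast
qed

section \<open>The branching subgroup contains a level stabilizer\<close>

definition fixes_level :: "nat \<Rightarrow> ('p mod_ring list \<Rightarrow> 'p mod_ring list) \<Rightarrow> bool" where
  "fixes_level n g \<longleftrightarrow> (\<forall>v. length v = n \<longrightarrow> g v = v)"

lemma word_rep_fixes_level_0:
  assumes "word_rep g t y" "fixes_level (Suc n) g"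
  shows "t = 0"
proof -
  obtain s where "\<And>x w. g (x # w) = (x + t) # s x w"
    using word_rep_sections[OF assms(1)] by blast
  then show ?thesis using assms(2)[unfolded fixes_level_def, rule_format, of "0 # replicate n 0"] by simp
qed

text \<open>Each further fixed level yields one more coordinate, from the last downwards. The
  sections have zero rotation sums, so \<open>omega f y = 0\<close>; then \<open>rho\<close> merely
  shifts \<open>y\<close>, and vanishing coordinates of the sections pass to
  \<open>rho f y\<close>.\<close>

lemma word_rep_fixes_level:
  "word_rep g t y \<Longrightarrow> fixes_level (Suc n) g \<Longrightarrow> j < n \<Longrightarrow> j < degree f \<Longrightarrow> y $ (degree f - 1 - j) = 0"
proof (induction n arbitrary: g t y j)
  case (Suc n)
  let ?m = "degree f"
  have y: "y \<in> V" using Suc.prems(1) by (rule word_rep_carrier)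
  obtain s ts ys where s: "\<And>x. word_rep (s x) (ts x) (ys x)" "\<And>x w. g (x # w) = (x + t) # s x w"
    and sums: "(\<Sum>x\<in>UNIV. ts x) = omega f y" "\<And>j. j < ?m \<Longrightarrow> (\<Sum>x\<in>UNIV. ys x $ j) = rho f y $ j"
    using word_rep_sections[OF Suc.prems(1)] by blast
  have fixed: "fixes_level (Suc n) (s x)" for x
    unfolding fixes_level_def
  proof (intro allI impI)
    fix w :: "'p mod_ring list" assume "length w = Suc n"
    then have "g (x # w) = x # w" using Suc.prems(2) unfolding fixes_level_def by simp
    then show "s x w = w" by (simp add: s(2))
  qed
  have last: "y $ (?m - 1) = 0"
    using sums(1) word_rep_fixes_level_0[OF s(1) fixed] by (simp add: omega_def)
  show ?case
  proof (cases j)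
    case 0
    then show ?thesis using last by simp
  next
    case (Suc i)
    then have i: "?m - 1 - i < ?m" "?m - 1 - i \<noteq> 0" using Suc.prems by auto
    have "rho f y $ (?m - 1 - i) = 0"
      using sums(2)[OF i(1)] Suc.IH[OF s(1) fixed, of i] Suc Suc.prems by simp
    then show ?thesis using rho_index[OF y i(1)] i last Suc by simp
  qed
qed simp

lemma word_rep_fixes_level_eq_0:
  assumes "word_rep g t y" "fixes_level (Suc n) g" "degree f \<le> n"
  shows "y = 0\<^sub>v (degree f)"
proof (rule eq_vecI)
  fix i assume "i < dim_vec (0\<^sub>v (degree f) :: 'p mod_ring vec)"
  then have "i < degree f" by simp
  then show "y $ i = 0\<^sub>v (degree f) $ i"
    using word_rep_fixes_level[OF assms(1,2), of "degree f - 1 - i"] assms(3) by simp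
qed (use word_rep_carrier[OF assms(1)] in auto)

text \<open>Modulo \<open>N\<close> the letters of \<open>A\<close> and \<open>B\<close> commute, so
  a word can be collected into its exponent sums.\<close>

lemma word_rep_normal_form:
  assumes N: "normal_sub N" and comm: "\<And>t y. y \<in> V \<Longrightarrow> comm (act_A t) (act_B f y) \<in> N"
    and "word_rep g t y"
  shows "\<exists>k\<in>N. g = act_A t \<circ> act_B f y \<circ> k"
  using assms(3)
proof (induction rule: word_rep.induct)
  show "\<exists>k\<in>N. id = act_A 0 \<circ> act_B f (0\<^sub>v (degree f)) \<circ> k"
    using normal_subD(2)[OF N] by (intro bexI[of _ id]) (auto simp: fun_eq_iff)
next
  fix g t y l assume "\<exists>k\<in>N. g = act_A t \<circ> act_B f y \<circ> k"
  then show "\<exists>k\<in>N. act_A l \<circ> g = act_A (l + t) \<circ> act_B f y \<circ> k"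
    by (auto simp: fun_eq_iff act_A_add)
next
  fix g t y z assume "word_rep g t y" and z: "z \<in> V" and "\<exists>k\<in>N. g = act_A t \<circ> act_B f y \<circ> k"
  then obtain k where k: "k \<in> N" "g = act_A t \<circ> act_B f y \<circ> k" and y: "y \<in> V"
    by (auto intro: word_rep_carrier)
  \<comment> \<open>The correction satisfies \<open>act_B f z \<circ> act_A t = act_A t \<circ>
    act_B f z \<circ> ?c\<close>; a conjugation then moves it past \<open>act_B f y\<close>.\<close>
  let ?c = "inv (comm (act_A (- t)) (act_B f (- z)))"
  let ?k = "act_B f (- y) \<circ> ?c \<circ> inv (act_B f (- y)) \<circ> k"
  have "?k \<in> N"
    using y z k(1) by (intro normal_subD(3)[OF N] normal_subD(5)[OF N] normal_subD(4)[OF N] comm) auto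
  moreover have "act_B f z \<circ> g = act_A t \<circ> act_B f (z + y) \<circ> ?k"
  proof -
    have "?c = act_B f (- z) \<circ> act_A (- t) \<circ> act_B f z \<circ> act_A t"
      using inv_comm[of "act_A (- t)" "act_B f (- z)"] z by (simp add: comm_def inv_act_A inv_act_B)
    moreover have "z + y + (- y + - z) = 0\<^sub>v (degree f)"
      using y z by (auto intro!: eq_vecI)
    ultimately show ?thesis
      using y z by (simp add: k(2) fun_eq_iff inv_act_B act_A_add act_B_add)
  qed
  ultimately show "\<exists>k\<in>N. act_B f z \<circ> g = act_A t \<circ> act_B f (z + y) \<circ> k" by blast
qed

lemma normal_sub_comm_right: "normal_sub N \<Longrightarrow> comm g h \<in> N \<Longrightarrow> g \<in> G \<Longrightarrow> h \<in> G \<Longrightarrow> comm h g \<in> N"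
  using normal_subD(4)[of N "comm g h"] by (simp add: inv_comm)

text \<open>Modulo \<open>K\<close> these elements commute with \<open>A\<close> by the choice of
  generators of \<open>K\<close>, and with \<open>B\<close> because \<open>B\<close> is abelian;
  commutators with products then expand.\<close>

lemma K_central:
  assumes y: "y \<in> B0" and "g \<in> G"
  shows "comm (act_B f (rho f y)) g \<in> K"
  using assms(2)
proof (induction rule: G_induct)
  let ?c = "act_B f (rho f y)"
  have step: "comm ?c (h \<circ> g) \<in> K" if "h \<in> G" "g \<in> G" "comm ?c h \<in> K" "comm ?c g \<in> K" for g h
  proof -
    have "comm ?c (h \<circ> g) = comm ?c h \<circ> (h \<circ> comm ?c g \<circ> inv h)"
      using that by (simp add: fun_eq_iff comm_def G_inv_comp)
    then show ?thesis using that normal_subD(3,5)[OF normal_sub_K] by simp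
  qed
  have "comm ?c id = id" by (simp add: fun_eq_iff comm_def)
  then show "comm ?c id \<in> K" using normal_subD(2)[OF normal_sub_K] by simp
  show "comm ?c (act_A k \<circ> g) \<in> K" if "g \<in> G" "comm ?c g \<in> K" for g k
    using that normal_sub_comm_right[OF normal_sub_K K_comm[OF y, of k]] by (intro step) simp_all
  show "comm ?c (act_B f z \<circ> g) \<in> K" if "g \<in> G" "z \<in> V" "comm ?c g \<in> K" for g z
  proof (rule step)
    have "rho f y + (z + (- rho f y + - z)) = 0\<^sub>v (degree f)"
      using that by (auto intro!: eq_vecI)
    then have "comm ?c (act_B f z) = id"
      using that by (simp add: fun_eq_iff comm_def inv_act_B act_B_add)
    then show "comm ?c (act_B f z) \<in> K" using normal_subD(2)[OF normal_sub_K] by simp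
  qed (use that in simp_all)
qed

section \<open>Exponent sums and commutators for p = 2\<close>

lemma uminus_mod_ring_2:
  assumes "CARD('p) = 2"
  shows "- x = (x :: 'p mod_ring)"
  using mod_ring_2_cases[OF assms, of x] mod_ring_2_cases[OF assms, of "- 1"] by auto

lemma uminus_vec_2:
  assumes "CARD('p) = 2" "y \<in> V"
  shows "- y = y"
  using assms by (intro eq_vecI) (auto simp: uminus_mod_ring_2)

text \<open>An invariant of \<open>K\<close> that later excludes an additional coset. The admissible
  sums form a subgroup, conjugation permutes the sections and conjugates them, which preserves the
  sums, and signs are invisible modulo 2.\<close>

lemma K_sections_word_rep:
  assumes two: "CARD('p) = 2"
  assumes "k \<in> K"
  shows "\<exists>y\<in>B0. \<exists>h. word_rep h (omega f (rho f y)) (rho f (rho f y)) \<and> (\<forall>w. k (x # w) = x # h w)"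
proof -
  let ?P = "\<lambda>k x. \<exists>y\<in>B0. \<exists>h. word_rep h (omega f (rho f y)) (rho f (rho f y)) \<and> (\<forall>w. k (x # w) = x # h w)"
  let ?M = "{k\<in>G. \<forall>x. ?P k x}"
  have zero: "0\<^sub>v (degree f) \<in> B0" by (simp add: B0_def omega_zero[OF deg])
  have id: "?P id x" for x
    using zero word_id
    by (intro bexI[of _ "0\<^sub>v (degree f)"] exI[of _ "id"]) (simp_all add: rho_zero omega_zero[OF deg] id_def)
  have "K \<subseteq> ?M"
  proof (rule K_least)
    have "?P (k \<circ> l) x" if kl: "?P k x" "?P l x" for k l x
    proof -
      from kl obtain y h z j where y: "y \<in> B0" "word_rep h (omega f (rho f y)) (rho f (rho f y))"
        "\<And>w. k (x # w) = x # h w" and z: "z \<in> B0" "word_rep j (omega f (rho f z)) (rho f (rho f z))"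
        "\<And>w. l (x # w) = x # j w" by blast
      have V: "y \<in> V" "z \<in> V" using y z by (auto intro: B0_V)
      have "y + z \<in> B0" using y(1) z(1) V by (auto simp: B0_def omega_add[OF deg])
      moreover have "word_rep (h \<circ> j) (omega f (rho f (y + z))) (rho f (rho f (y + z)))"
        using word_rep_comp[OF y(2) z(2)] V by (simp add: rho_add omega_add[OF deg])
      moreover have "\<forall>w. (k \<circ> l) (x # w) = x # (h \<circ> j) w" by (simp add: y z)
      ultimately show ?thesis by blast
    qed
    moreover have "?P (inv k) x" if k: "k \<in> G" "?P k x" for k x
    proof -
      from k(2) obtain y h where y: "y \<in> B0" "word_rep h (omega f (rho f y)) (rho f (rho f y))"
        "\<And>w. k (x # w) = x # h w" by blast
      have V: "y \<in> V" using y by (auto intro: B0_V)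
      have "- y \<in> B0" using y(1) V by (auto simp: B0_def omega_uminus[OF deg])
      moreover have "word_rep (inv h) (omega f (rho f (- y))) (rho f (rho f (- y)))"
        using word_rep_inv[OF y(2)] V by (simp add: rho_uminus omega_uminus[OF deg])
      moreover have "inv k (x # w) = x # inv h w" for w
      proof -
        have "h \<in> G" using y(2) by (auto simp: G_def)
        then have "k (x # inv h w) = x # w" by (simp add: y(3))
        then show ?thesis using k(1) by (metis G_inv_left)
      qed
      ultimately show ?thesis by blast
    qed
    moreover have "?P (g \<circ> k \<circ> inv g) x" if g: "g \<in> G" and k: "\<And>x. ?P k x" for g k x
    proof -
      obtain t e where "word_rep g t e" using g by (auto simp: G_def)
      then obtain s ts ys where s: "\<And>x. word_rep (s x) (ts x) (ys x)" "\<And>x w. g (x # w) = (x + t) # s x w"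
        using word_rep_sections by blast
      \<comment> \<open>\<open>inv g\<close> carries \<open>x\<close> to \<open>x - t\<close>, so
        \<open>k\<close> is read at that letter.\<close>
      obtain y h where y: "y \<in> B0" "word_rep h (omega f (rho f y)) (rho f (rho f y))"
        "\<And>w. k ((x - t) # w) = (x - t) # h w" using k by blast
      let ?s = "s (x - t)"
      have sG: "?s \<in> G" using s(1) by (auto simp: G_def)
      have "inv g (x # w) = (x - t) # inv ?s w" for w
      proof -
        have "g ((x - t) # inv ?s w) = x # w" using sG by (simp add: s(2))
        then show ?thesis using g by (metis G_inv_left)
      qed
      then have "\<forall>w. (g \<circ> k \<circ> inv g) (x # w) = x # (?s \<circ> h \<circ> inv ?s) w" by (simp add: y(3) s(2))
      moreover have "word_rep (?s \<circ> h \<circ> inv ?s) (omega f (rho f y)) (rho f (rho f y))"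
      proof -
        have "ys (x - t) + rho f (rho f y) + - ys (x - t) = rho f (rho f y)"
          using word_rep_carrier[OF s(1)[of "x - t"]] by (auto intro!: eq_vecI)
        then show ?thesis
          using word_rep_comp[OF word_rep_comp[OF s(1)[of "x - t"] y(2)], of "inv ?s" "- ts (x - t)" "- ys (x - t)"]
            word_rep_inv[OF s(1)[of "x - t"]] by simp
      qed
      ultimately show ?thesis using y(1) by blast
    qed
    ultimately show "normal_sub ?M"
      unfolding normal_sub_def using id by (simp add: G_comp G_inv)
  next
    fix t y assume y: "y \<in> B0"
    let ?c = "rho f y"
    have "?P (comm (act_A t) (act_B f ?c)) x" for x
    proof -
      consider "t = 0" | "t = 1" "x = 0" | "t = 1" "x = 1"
        using mod_ring_2_cases[OF two] by blast
      then show ?thesis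
      proof cases
        case 1
        then have "comm (act_A t) (act_B f ?c) = id"
          by (simp add: comm_def fun_eq_iff inv_act_A)
        then show ?thesis using id by simp
      next
        case 2
        have rep: "word_rep (act_B f (rho f ?c) \<circ> act_A (- omega f ?c)) (omega f ?c) (rho f ?c)"
          using word_rep_comp[OF word_rep_act_B[of "rho f ?c"] word_rep_act_A[of "- omega f ?c"]]
          by (simp add: uminus_mod_ring_2[OF two])
        show ?thesis using 2 y rep comm_act_section[of ?c, OF rho_closed] by blast
      next
        case 3
        have "word_rep (act_A (omega f ?c) \<circ> act_B f (- rho f ?c)) (omega f ?c) (rho f ?c)"
          using word_rep_comp[OF word_rep_act_A[of "omega f ?c"] word_rep_act_B[of "- rho f ?c"]]
          by (simp add: uminus_vec_2[OF two])
        moreover have "comm (act_A 1) (act_B f ?c) (1 # w) = 1 # (act_A (omega f ?c) \<circ> act_B f (- rho f ?c)) w" for w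
          using uminus_mod_ring_2[OF two, of 1] by (simp add: comm_def inv_act_A inv_act_B rho_uminus)
        ultimately show ?thesis using 3 y by blast
      qed
    qed
    then show "comm (act_A t) (act_B f ?c) \<in> ?M" by (simp add: comm_in_G)
  qed
  then show ?thesis using assms(2) by blast
qed

lemma exists_omega_1_omega_rho_0:
  assumes two: "CARD('p) = 2" and m: "degree f \<ge> 2"
  obtains y where "y \<in> V" "omega f y = 1" "omega f (rho f y) = 0"
proof -
  let ?m = "degree f"
  \<comment> \<open>The entry before the last cancels what \<open>rho\<close> subtracts in the last
    coordinate.\<close>
  define y where "y = vec ?m (\<lambda>i. if i = ?m - 1 then 1 else if i = ?m - 2 then coeff f (?m - 1) else 0)"
  have y: "y \<in> V" by (simp add: y_def)
  have "?m - 1 < ?m" "?m - 2 < ?m" "?m - 1 \<noteq> 0" "?m - 1 - 1 = ?m - 2" "?m - 2 \<noteq> ?m - 1" using m by auto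
  then have "omega f y = 1" "omega f (rho f y) = 0"
    using rho_index[OF y, of "?m - 1"] by (auto simp: omega_def y_def)
  then show ?thesis using y that by blast
qed

text \<open>
  For \<open>p = 2\<close> the group \<open>G\<close> is generated modulo \<open>K\<close> by central elements together with \<open>a\<close> and one
  involution \<open>b = act_B f (rho f y)\<close>, and \<open>z = [a, b]\<close> is an involution. So \<open>K \<union> z K\<close> contains all
  commutators of generators.
\<close>

lemma normal_sub_K_union:
  assumes two: "CARD('p) = 2" and y: "y \<in> V" "omega f y = 1" "omega f (rho f y) = 0"
  defines "z \<equiv> comm (act_A 1) (act_B f (rho f y))"
  shows "\<And>x w. z (x # w) = x # act_B f (rho f (rho f y)) w"
    and "normal_sub (K \<union> {z \<circ> k | k. k \<in> K})"
    and "\<And>t u. u \<in> V \<Longrightarrow> comm (act_A t) (act_B f u) \<in> K \<union> {z \<circ> k | k. k \<in> K}"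
proof -
  let ?y = "rho f y" and ?M = "K \<union> {z \<circ> k | k. k \<in> K}"
  have zG: "z \<in> G" by (simp add: z_def comm_in_G)
  \<comment> \<open>Because \<open>omega f (rho f y) = 0\<close> and signs do not matter, the
    commutator has the same section at both letters.\<close>
  show z: "z (x # w) = x # act_B f (rho f ?y) w" for x w
  proof -
    consider "x = 0" | "x = 1" using mod_ring_2_cases[OF two] by blast
    then show ?thesis
    proof cases
      case 1
      then show ?thesis using y comm_act_section[of ?y] by (simp add: z_def)
    next
      case 2
      then show ?thesis using y uminus_mod_ring_2[OF two, of 1]
        by (simp add: z_def comm_def inv_act_A inv_act_B rho_uminus omega_uminus[OF deg] uminus_vec_2[OF two])
    qed
  qed
  have z_Nil: "z [] = []" using zG by simp
  have zz: "z (z w) = w" for w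
  proof (cases w)
    case (Cons x v)
    have "rho f ?y + rho f ?y = 0\<^sub>v (degree f)"
      using uminus_vec_2[OF two, of "rho f ?y"] by (metis rho_closed uminus_r_inv_vec)
    then show ?thesis by (simp add: Cons z act_B_add)
  qed (simp add: z_Nil)
  have inv_z: "inv z = z" using zz by (intro inv_unique_comp) (auto simp: fun_eq_iff)
  have K: "k \<in> K \<Longrightarrow> k \<in> ?M" "k \<in> K \<Longrightarrow> z \<circ> k \<in> ?M" for k by auto
  have K_z: "z \<circ> k \<circ> z \<in> K" if "k \<in> K" for k
    using normal_subD(5)[OF normal_sub_K zG that] inv_z by simp
  have K_G: "k \<in> K \<Longrightarrow> k \<in> G" for k by (rule normal_subD(1)[OF normal_sub_K])
  have M_G: "?M \<subseteq> G" using K_G zG G_comp by auto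
  have comp: "k \<circ> l \<in> ?M" if "k \<in> ?M" "l \<in> ?M" for k l
  proof -
    from that obtain k1 l1 where kl: "k1 \<in> K" "k = k1 \<or> k = z \<circ> k1" "l1 \<in> K" "l = l1 \<or> l = z \<circ> l1"
      by blast
    have e: "k1 \<circ> (z \<circ> l1) = z \<circ> (z \<circ> k1 \<circ> z \<circ> l1)" "z \<circ> k1 \<circ> l1 = z \<circ> (k1 \<circ> l1)"
      "z \<circ> k1 \<circ> (z \<circ> l1) = z \<circ> k1 \<circ> z \<circ> l1"
      by (simp_all add: fun_eq_iff zz)
    have "k1 \<circ> l1 \<in> K" "z \<circ> k1 \<circ> z \<circ> l1 \<in> K"
      using normal_subD(3)[OF normal_sub_K] K_z kl by simp_all
    then have M: "k1 \<circ> l1 \<in> ?M" "z \<circ> (k1 \<circ> l1) \<in> ?M" "z \<circ> k1 \<circ> z \<circ> l1 \<in> ?M"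
      "z \<circ> (z \<circ> k1 \<circ> z \<circ> l1) \<in> ?M" by (simp_all only: K)
    from kl(2,4) show ?thesis by (elim disjE) (simp_all only: e M)
  qed
  have inv: "inv k \<in> ?M" if "k \<in> ?M" for k
  proof -
    have "inv (z \<circ> l) = z \<circ> (z \<circ> inv l \<circ> z)" if "l \<in> K" for l
      using K_G[OF that] zG by (simp add: G_inv_comp inv_z fun_eq_iff zz)
    then show ?thesis using that normal_subD(4)[OF normal_sub_K] K_z by auto
  qed
  have conj_B0: "act_B f (rho f u) \<circ> z \<circ> inv (act_B f (rho f u)) \<in> ?M" if u: "u \<in> B0" for u
  proof -
    let ?c = "act_B f (rho f u)"
    \<comment> \<open>\<open>?c\<close> is central modulo \<open>K\<close>, and the right-hand side
      has the form \<open>z \<circ> k\<close>.\<close>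
    have "?c \<circ> z \<circ> inv ?c = z \<circ> (z \<circ> comm ?c z \<circ> z)"
      by (simp add: fun_eq_iff comm_def inv_z zz)
    then show ?thesis using K_z[OF K_central[OF u zG]] by auto
  qed
  \<comment> \<open>\<open>B0\<close> has two cosets in \<open>V\<close>, told apart by
    \<open>omega\<close>; \<open>y\<close> represents the nontrivial one.\<close>
  have split: "u \<in> B0 \<or> u - y \<in> B0 \<and> rho f u = rho f (u - y) + ?y" if u: "u \<in> V" for u
  proof -
    have "omega f (u - y) = 0" if "omega f u = 1"
      using that u y deg by (simp add: omega_def)
    moreover have "u - y + y = u" using u y by (auto intro!: eq_vecI)
    then have "rho f u = rho f (u - y) + ?y" using u y by (metis minus_carrier_vec rho_add)
    ultimately show ?thesis using u y mod_ring_2_cases[OF two, of "omega f u"] by (auto simp: B0_def)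
  qed
  have B_y: "act_B f ?y \<circ> z = z \<circ> act_B f ?y"
  proof
    fix w
    have "rho f ?y + rho f (rho f y) = rho f (rho f y) + rho f ?y" by simp
    then show "(act_B f ?y \<circ> z) w = (z \<circ> act_B f ?y) w"
      using y z z_Nil by (cases w) (auto simp: z)
  qed
  have conj_B: "act_B f u \<circ> z \<circ> inv (act_B f u) \<in> ?M" if u: "u \<in> V" for u
  proof -
    obtain v where v: "v \<in> V" "rho f v = u" using rho_surj[OF deg coeff_0 u] by blast
    from split[OF v(1)] show ?thesis
    proof
      assume "v \<in> B0"
      then show ?thesis using conj_B0 v by blast
    next
      assume v': "v - y \<in> B0 \<and> rho f v = rho f (v - y) + ?y"
      let ?c = "act_B f (rho f (v - y))"
      have "act_B f u = ?c \<circ> act_B f ?y" using v v' by (auto simp: fun_eq_iff act_B_add)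
      then have "act_B f u \<circ> z \<circ> inv (act_B f u) = ?c \<circ> (act_B f ?y \<circ> z) \<circ> inv (act_B f ?y) \<circ> inv ?c"
        by (simp add: G_inv_comp comp_assoc)
      also have "\<dots> = ?c \<circ> z \<circ> inv ?c"
        by (simp add: B_y fun_eq_iff)
      finally show ?thesis using conj_B0 v' by simp
    qed
  qed
  have conj_A: "act_A t \<circ> z \<circ> inv (act_A t) = z" for t
  proof
    show "(act_A t \<circ> z \<circ> inv (act_A t)) w = z w" for w
      by (cases w) (auto simp: z z_Nil inv_act_A)
  qed
  have conj: "g \<circ> k \<circ> inv g \<in> ?M" if "g \<in> G" "k \<in> ?M" for g k
    using that
  proof (induction arbitrary: k rule: G_induct)
    have *: "g \<circ> k \<circ> inv g \<in> ?M" if "g \<in> G" "g \<circ> z \<circ> inv g \<in> ?M" "k \<in> ?M" for g k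
    proof -
      have *: "g \<circ> (z \<circ> l) \<circ> inv g = g \<circ> z \<circ> inv g \<circ> (g \<circ> l \<circ> inv g)" for l
        using that(1) by (simp add: fun_eq_iff)
      have l: "g \<circ> l \<circ> inv g \<in> ?M" if "l \<in> K" for l
        by (rule K(1)[OF normal_subD(5)[OF normal_sub_K \<open>g \<in> G\<close> that]])
      from that(3) show ?thesis
      proof (rule UnE)
        assume "k \<in> {z \<circ> k | k. k \<in> K}"
        then obtain l' where "l' \<in> K" "k = z \<circ> l'" by blast
        then show ?thesis using comp[OF that(2) l] by (simp only: *)
      qed (rule l)
    qed
    have **: "h \<circ> g \<circ> k \<circ> inv (h \<circ> g) = h \<circ> (g \<circ> k \<circ> inv g) \<circ> inv h" if "h \<in> G" "g \<in> G" for g h k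
      using that by (simp add: G_inv_comp fun_eq_iff)
    show "id \<circ> k \<circ> inv id \<in> ?M" if "k \<in> ?M" for k using that by simp
    show "act_A t \<circ> g \<circ> k \<circ> inv (act_A t \<circ> g) \<in> ?M"
      if "g \<in> G" "\<And>k. k \<in> ?M \<Longrightarrow> g \<circ> k \<circ> inv g \<in> ?M" "k \<in> ?M" for g t k
      unfolding **[OF G_act_A that(1)]
    proof (rule *)
      show "act_A t \<circ> z \<circ> inv (act_A t) \<in> ?M"
        using K(2)[OF normal_subD(2)[OF normal_sub_K]] by (simp only: conj_A comp_id)
    qed (use that in simp_all)
    show "act_B f u \<circ> g \<circ> k \<circ> inv (act_B f u \<circ> g) \<in> ?M"
      if "g \<in> G" "u \<in> V" "\<And>k. k \<in> ?M \<Longrightarrow> g \<circ> k \<circ> inv g \<in> ?M" "k \<in> ?M" for g u k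
      unfolding **[OF G_act_B[OF that(2)] that(1)]
      by (rule *[OF G_act_B[OF that(2)] conj_B[OF that(2)] that(3)[OF that(4)]])
  qed
  show M: "normal_sub ?M"
    unfolding normal_sub_def
  proof (intro conjI ballI)
    show "id \<in> ?M" by (rule K(1)[OF normal_subD(2)[OF normal_sub_K]])
  qed (rule M_G comp inv conj; assumption?)+
  show "comm (act_A t) (act_B f u) \<in> ?M" if u: "u \<in> V" for t u
  proof (cases "t = 0")
    case True
    then have "comm (act_A t) (act_B f u) = id" using u by (simp add: comm_def fun_eq_iff inv_act_A)
    then show ?thesis using normal_subD(2)[OF M] by simp
  next
    case False
    then have t: "t = 1" using mod_ring_2_cases[OF two] by blast
    obtain v where v: "v \<in> V" "rho f v = u" using rho_surj[OF deg coeff_0 u] by blast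
    from split[OF v(1)] show ?thesis
    proof
      assume "v \<in> B0"
      then show ?thesis using K_comm v by blast
    next
      assume v': "v - y \<in> B0 \<and> rho f v = rho f (v - y) + ?y"
      let ?c = "act_B f (rho f (v - y))"
      have u: "act_B f u = ?c \<circ> act_B f ?y" using v v' by (auto simp: fun_eq_iff act_B_add)
      have "comm (act_A t) (act_B f u) = comm (act_A 1) ?c \<circ> (?c \<circ> z \<circ> inv ?c)"
        unfolding u by (simp add: t z_def comm_def G_inv_comp fun_eq_iff)
      then show ?thesis using comp[OF K(1)[OF K_comm] conj_B0] v' by simp
    qed
  qed
qed

text \<open>Fixing level \<open>degree f + 1\<close> already makes the exponent sums of
  \<open>g\<close> vanish. The extra level serves p = 2, where a section of \<open>g\<close> must
  have zero sums too.\<close>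

lemma K_contains_stabilizer:
  assumes g: "g \<in> G" "fixes_level (degree f + 2) g"
  shows "g \<in> K"
proof -
  let ?m = "degree f"
  have sub: "fixes_level n h" if "fixes_level (Suc n) g" "\<And>w. g (x # w) = x # h w" for n g h and x :: "'p mod_ring"
    using that unfolding fixes_level_def by (metis length_Cons list.inject)
  have zero: "t = 0 \<and> y = 0\<^sub>v ?m" if "word_rep h t y" "fixes_level (Suc n) h" "?m \<le> n" for h t y n
    using that word_rep_fixes_level_0 word_rep_fixes_level_eq_0 by blast
  have "word_rep g 0 (0\<^sub>v ?m)" using g zero[of g _ _ "?m + 1"] by (auto simp: G_def)
  have normal: "g \<in> N" if N: "normal_sub N" "\<And>t y. y \<in> V \<Longrightarrow> comm (act_A t) (act_B f y) \<in> N" for N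
  proof -
    obtain k where "k \<in> N" "g = act_A 0 \<circ> act_B f (0\<^sub>v ?m) \<circ> k"
      using word_rep_normal_form[OF N \<open>word_rep g 0 (0\<^sub>v ?m)\<close>] by blast
    moreover from this have "g = k" by (simp add: fun_eq_iff)
    ultimately show ?thesis by simp
  qed
  show ?thesis
  proof (cases "CARD('p) = 2")
    case False
    have "comm (act_A t) (act_B f y) \<in> K" if y: "y \<in> V" for t y
    proof -
      obtain u where "u \<in> V" "rho f u = y" using rho_surj[OF deg coeff_0 y] by blast
      then show ?thesis using K_comm[of u t] False by (auto simp: B0_def)
    qed
    then show ?thesis by (rule normal[OF normal_sub_K])
  next
    case two: True
    obtain y where y: "y \<in> V" "omega f y = 1" "omega f (rho f y) = 0"
      using exists_omega_1_omega_rho_0[OF two deg_2[OF two]] by blast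
    define z where "z = comm (act_A 1) (act_B f (rho f y))"
    note z = normal_sub_K_union[OF two y, folded z_def]
    have "g \<in> K \<union> {z \<circ> k | k. k \<in> K}" using z(2,3) by (rule normal)
    moreover have False if k: "k \<in> K" "g = z \<circ> k" for k
    proof -
      obtain u h where u: "u \<in> B0" "word_rep h (omega f (rho f u)) (rho f (rho f u))" "\<And>w. k (0 # w) = 0 # h w"
        using K_sections_word_rep[OF two k(1), of 0] by blast
      \<comment> \<open>This is the section of \<open>g\<close> at 0. Its \<open>B\<close> sum is
        \<open>rho\<close> applied twice to \<open>y + u\<close>, which is nonzero since
        \<open>omega f (y + u) = 1\<close>.\<close>
      let ?h = "act_B f (rho f (rho f y)) \<circ> h"
      have "fixes_level (Suc ?m) ?h"
        by (rule sub[of "Suc ?m" g 0]) (use g(2) in \<open>simp_all add: k(2) u(3) z(1)\<close>)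
      moreover have "word_rep ?h (omega f (rho f u)) (rho f (rho f y) + rho f (rho f u))"
        by (rule word_B[OF u(2)]) simp
      ultimately have "rho f (rho f y) + rho f (rho f u) = 0\<^sub>v ?m" using zero by blast
      then have "rho f (rho f (y + u)) = rho f (rho f (0\<^sub>v ?m))"
        using y(1) B0_V[OF u(1)] by (simp add: rho_add rho_zero)
      then have "y + u = 0\<^sub>v ?m"
        using y(1) B0_V[OF u(1)] by (intro rho_inj[OF coeff_0, of "y + u"] rho_inj[OF coeff_0, of "rho f (y + u)"]) auto
      then have "omega f (y + u) = 0" by (simp add: omega_zero[OF deg])
      moreover have "omega f (y + u) = 1"
        using u(1) y two B0_V[OF u(1)] by (simp add: omega_add[OF deg] B0_def)
      ultimately show False by simp
    qed
    ultimately show ?thesis by blast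
  qed
qed

section \<open>Normal subgroups\<close>

text \<open>Conjugation brings the moved vertex onto the ray of zeros, on which fractality and the
  copies of \<open>K\<close> are available.\<close>

lemma nontrivial_normal_sub_moves_zeros:
  assumes N: "normal_sub N" and "g \<in> N" "g \<noteq> id"
  obtains h n where "h \<in> N" "h (replicate n 0) \<noteq> replicate n 0"
proof -
  obtain v where v: "g v \<noteq> v" using assms(3) by (auto simp: fun_eq_iff)
  obtain t where t: "t \<in> G" "t v = replicate (length v) 0" using level_transitive by blast
  let ?h = "t \<circ> g \<circ> inv t" and ?z = "replicate (length v) 0"
  have "inv t ?z = v" using t by (metis G_inv_left)
  moreover have "t (g v) \<noteq> t v" using v G_bij[OF t(1)] by (simp add: bij_is_inj inj_eq)
  ultimately have "?h ?z \<noteq> ?z" using t(2) by simp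
  then show ?thesis using that normal_subD(5)[OF N t(1) assms(2)] by blast
qed

text \<open>
  If \<open>h\<close> moves the vertex \<open>v\<close>, then conjugation by \<open>h\<close> moves \<open>at_vertex v l\<close> to an element
  commuting with everything supported below \<open>v\<close>.
\<close>

lemma comm_at_moved_vertex:
  assumes N: "normal_sub N" and h: "h \<in> N" "h (replicate n 0) \<noteq> replicate n 0" and kl: "k \<in> K" "l \<in> K"
  shows "at_vertex (replicate n 0) (comm k l) \<in> N"
proof -
  let ?v = "replicate n 0 :: 'p mod_ring list"
  \<comment> \<open>With the inverse of \<open>k\<close> here, \<open>comm h ?k\<close> becomes
    \<open>e\<close> followed on the right by the copy of \<open>k\<close> itself, and
    \<open>e\<close> commutes with every copy at \<open>?v\<close>.\<close>
  let ?l = "at_vertex ?v l" and ?k = "at_vertex ?v (inv k)"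
  have G: "h \<in> G" "k \<in> G" "l \<in> G" using normal_subD(1) N normal_sub_K h kl by blast+
  have KG: "?l \<in> G" "?k \<in> G"
    using K_at_zeros kl normal_subD(4)[OF normal_sub_K] normal_subD(1)[OF normal_sub_K] by auto
  have inv: "inv ?l = at_vertex ?v (inv l)" "inv ?k = at_vertex ?v k"
    using G by (simp_all add: inv_at_vertex G_bij G_inv)
  define e where "e = h \<circ> ?k \<circ> inv h"
  have e: "e = at_vertex (h ?v) (vsection h ?v \<circ> inv k \<circ> inv (vsection h ?v))"
    unfolding e_def by (rule conj_at_vertex[OF G(1)])
  have eG: "e \<in> G" using KG G by (simp add: e_def G_comp G_inv)
  \<comment> \<open>Distinct words of equal length have no common extension.\<close>
  have disj: "?v @ u \<noteq> h ?v @ u'" for u u'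
    using h(2) G by (metis G_length append_eq_append_conv)
  have e_comm: "e (at_vertex ?v j w) = at_vertex ?v j (e w)" for j w
  proof (cases "\<exists>u. w = ?v @ u")
    case True
    then obtain u where u: "w = ?v @ u" by blast
    have "e (?v @ u) = ?v @ u" for u unfolding e by (rule at_vertex_other) (rule disj)
    then show ?thesis by (simp add: u)
  next
    case False
    then have jw: "at_vertex ?v j w = w" by (intro at_vertex_other) blast
    have "at_vertex ?v j (e w) = e w"
    proof (cases "\<exists>u. w = h ?v @ u")
      case True
      then obtain u where "w = h ?v @ u" by blast
      then have "e w = h ?v @ (vsection h ?v \<circ> inv k \<circ> inv (vsection h ?v)) u"
        unfolding e by (simp only: at_vertex_apply)
      then show ?thesis using disj by (metis at_vertex_other)
    next
      case False
      then have "e w = w" unfolding e by (intro at_vertex_other) blast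
      then show ?thesis by (simp add: jw)
    qed
    then show ?thesis by (simp add: jw)
  qed
  have inv_e_comm: "inv e (at_vertex ?v j w) = at_vertex ?v j (inv e w)" for j w
    using e_comm[of j "inv e w"] eG by (metis G_inv_left G_inv_right)
  have "comm h ?k \<in> N" using N h(1) KG(2) by (rule normal_sub_comm)
  then have "comm (comm h ?k) ?l \<in> N" by (rule normal_sub_comm[OF N _ KG(1)])
  also have "comm (comm h ?k) ?l = at_vertex ?v (comm k l)"
  proof -
    have c: "comm h ?k = e \<circ> at_vertex ?v k" by (simp add: comm_def e_def inv)
    have ic: "inv (comm h ?k) = ?k \<circ> inv e"
      using KG(2) G(1) inv_comm[of h ?k] eG unfolding c inv(2)[symmetric]
      by (simp add: G_inv_comp G_inv)
    show ?thesis
      unfolding comm_def[of "comm h ?k" ?l] ic unfolding c inv comm_def[of k l]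
      using eG by (simp add: fun_eq_iff at_vertex_comp e_comm inv_e_comm)
  qed
  finally show ?thesis .
qed

lemma normal_sub_contains_K_at_zeros:
  assumes N: "normal_sub N" and nontrivial: "g \<in> N" "g \<noteq> id"
  shows "\<exists>n. \<forall>k\<in>K. at_vertex (replicate n 0) k \<in> N"
proof -
  obtain h n where h: "h \<in> N" "h (replicate n 0) \<noteq> replicate n 0"
    using nontrivial_normal_sub_moves_zeros[OF N nontrivial] by blast
  obtain m where m: "sections m K = G" using K_sections by blast
  have "at_vertex (replicate (n + m) 0) (comm k g) \<in> N" if k: "k \<in> K" and g: "g \<in> G" for k g
  proof -
    let ?v = "replicate m 0 :: 'p mod_ring list"
    \<comment> \<open>An element of \<open>K\<close> with the arbitrary section \<open>g\<close>
      turns a commutator inside \<open>K\<close> into a copy of \<open>comm k g\<close>.\<close>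
    obtain q where q: "q \<in> K" "\<And>w. q (?v @ w) = ?v @ g w"
      using g unfolding m[symmetric] sections_def by blast
    have qG: "q \<in> G" using q normal_subD(1)[OF normal_sub_K] by blast
    have kG: "k \<in> G" using k normal_subD(1)[OF normal_sub_K] by blast
    have "q ?v = ?v" using q(2)[of "[]"] g by simp
    moreover have "vsection q ?v = g" using q qG by (intro vsection_eqI) auto
    ultimately have "q \<circ> at_vertex ?v (inv k) \<circ> inv q = at_vertex ?v (g \<circ> inv k \<circ> inv g)"
      using conj_at_vertex[OF qG, of ?v "inv k"] by simp
    then have "comm (at_vertex ?v k) q = at_vertex ?v k \<circ> at_vertex ?v (g \<circ> inv k \<circ> inv g)"
      using kG by (simp add: comm_def inv_at_vertex G_bij comp_assoc)
    also have "\<dots> = at_vertex ?v (comm k g)"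
      by (simp add: fun_eq_iff comm_def at_vertex_comp)
    finally have e: "comm (at_vertex ?v k) q = at_vertex ?v (comm k g)" .
    have "at_vertex (replicate (n + m) 0) j = at_vertex (replicate n 0) (at_vertex ?v j)" for j
      by (simp add: fun_eq_iff replicate_add at_vertex_append)
    then show ?thesis
      using comm_at_moved_vertex[OF N h K_at_zeros[OF k, of m] q(1)] by (simp add: e)
  qed
  then show ?thesis using K_at_Suc[OF N] by blast
qed

text \<open>Conjugating by \<open>t\<close> replaces \<open>k\<close> by its conjugate under a
  section of \<open>t\<close>, which stays in the normal subgroup \<open>K\<close>.\<close>

lemma normal_sub_contains_K_at_vertex:
  assumes N: "normal_sub N" and zeros: "\<And>k. k \<in> K \<Longrightarrow> at_vertex (replicate (length v) 0) k \<in> N" and k: "k \<in> K"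
  shows "at_vertex v k \<in> N"
proof -
  obtain t where t: "t \<in> G" "t v = replicate (length v) 0" using level_transitive by blast
  let ?s = "vsection t v"
  have "?s \<circ> k \<circ> inv ?s \<in> K" by (rule normal_subD(5)[OF normal_sub_K G_vsection(1)[OF t(1)] k])
  then have "t \<circ> at_vertex v k \<circ> inv t \<in> N"
    using zeros by (simp add: conj_at_vertex[OF t(1)] t(2))
  then have "inv t \<circ> (t \<circ> at_vertex v k \<circ> inv t) \<circ> inv (inv t) \<in> N"
    by (rule normal_subD(5)[OF N G_inv[OF t(1)]])
  also have "inv t \<circ> (t \<circ> at_vertex v k \<circ> inv t) \<circ> inv (inv t) = at_vertex v k"
    using t(1) by (simp add: fun_eq_iff)
  finally show ?thesis .
qed

lemma fixes_level_mono:
  assumes g: "g \<in> G" "fixes_level n g" and "length v \<le> n"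
  shows "g v = v"
proof -
  let ?u = "replicate (n - length v) 0"
  have "g (v @ ?u) = v @ ?u" using assms by (simp add: fixes_level_def)
  then show ?thesis using g(1) by (simp add: G_vsection(2))
qed

text \<open>An element fixing level \<open>n\<close> is the product of the copies of its sections
  there, and these sections fix enough levels to lie in \<open>K\<close>.\<close>

lemma normal_sub_contains_stabilizer:
  assumes N: "normal_sub N" and K_N: "\<And>v k. length v = n \<Longrightarrow> k \<in> K \<Longrightarrow> at_vertex v k \<in> N"
    and g: "g \<in> G" "fixes_level (n + (degree f + 2)) g"
  shows "g \<in> N"
proof -
  have fixed: "g v = v" if "length v \<le> n" for v
    using fixes_level_mono[OF g] that by simp
  have K: "vsection g v \<in> K" if v: "length v = n" for v
  proof (rule K_contains_stabilizer[OF G_vsection(1)[OF g(1)]])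
    show "fixes_level (degree f + 2) (vsection g v)"
      using g v by (simp add: fixes_level_def vsection_def)
  qed
  \<comment> \<open>The partial product over the vertices in \<open>F\<close>. Words shorter than
    \<open>n\<close> are left alone, as all members of \<open>F\<close> have length
    \<open>n\<close>.\<close>
  let ?P = "\<lambda>F w. if take n w \<in> F then g w else w"
  have "?P F \<in> N" if "finite F" "F \<subseteq> {v. length v = n}" for F
    using that
  proof (induction F rule: finite_induct)
    case empty
    then show ?case using normal_subD(2)[OF N] by (simp add: id_def)
  next
    case (insert v F)
    then have v: "length v = n" by simp
    have "?P (insert v F) w = (at_vertex v (vsection g v) \<circ> ?P F) w" for w
    proof (cases "take n w = v")
      case True
      then have "w = v @ drop n w" by (metis append_take_drop_id)
      then have "at_vertex v (vsection g v) w = g w"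
        using G_vsection(2)[OF g(1), of v "drop n w"] fixed[of v] v by (metis at_vertex_apply le_refl)
      then show ?thesis using True insert.hyps by simp
    next
      case False
      have "w \<noteq> v @ u" for u using False v by auto
      then have 1: "at_vertex v (vsection g v) w = w" by (rule at_vertex_other)
      have "g w \<noteq> v @ u" for u
      proof
        assume u: "g w = v @ u"
        have "g w = take n w @ vsection g (take n w) (drop n w)"
          using G_vsection(2)[OF g(1), of "take n w" "drop n w"] fixed[of "take n w"] by simp
        moreover have "length (g w) = n + length u" using u v by simp
        then have "length (take n w) = n" using g(1) by simp
        ultimately have "take n w = v" using u v by (metis append_eq_append_conv)
        then show False using False by simp
      qed
      then have 2: "at_vertex v (vsection g v) (g w) = g w" by (rule at_vertex_other)
      show ?thesis using False 1 2 by simp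
    qed
    then have "?P (insert v F) = at_vertex v (vsection g v) \<circ> ?P F" by blast
    then show ?case using normal_subD(3)[OF N K_N[OF v K[OF v]]] insert by simp
  qed
  moreover have "finite {v :: 'p mod_ring list. length v = n}"
    using finite_lists_length_eq[of "UNIV :: 'p mod_ring set" n] by simp
  ultimately have "?P {v. length v = n} \<in> N" by blast
  also have "?P {v. length v = n} = g"
    using fixed by (auto simp: fun_eq_iff)
  finally show ?thesis .
qed

section \<open>Subgroups of finite index\<close>

lemma infinite_G: "infinite G"
proof
  assume fin: "finite G"
  let ?S = "{g \<in> G. g [0] = [0]}"
  \<comment> \<open>Sections at \<open>[0]\<close> map the stabilizer of \<open>[0]\<close> onto
    \<open>G\<close>, although this stabilizer is a proper subset.\<close>
  have "G \<subseteq> (\<lambda>g. vsection g [0]) ` ?S"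
  proof
    fix h assume "h \<in> G"
    then obtain g where "g \<in> G" "g (replicate 1 0) = replicate 1 0" "vsection g (replicate 1 0) = h"
      by (rule lift_zeros)
    then show "h \<in> (\<lambda>g. vsection g [0]) ` ?S" by force
  qed
  then have "card G \<le> card ?S" using fin by (intro surj_card_le) auto
  moreover have "act_A 1 \<in> G - ?S" by simp
  then have "?S \<subset> G" by blast
  then have "card ?S < card G" using fin by (rule psubset_card_mono[rotated])
  ultimately show False by simp
qed

text \<open>The normal core \<open>N\<close> of \<open>H\<close> is nontrivial by the pigeonhole
  principle: the infinite group \<open>G\<close> permutes finitely many cosets, so two elements act
  alike and their quotient lies in \<open>N\<close>.\<close>

lemma finite_index_contains_stabilizer:
  assumes H: "H \<subseteq> G" "id \<in> H" "\<And>g h. g \<in> H \<Longrightarrow> h \<in> H \<Longrightarrow> g \<circ> h \<in> H" "\<And>g. g \<in> H \<Longrightarrow> inv g \<in> H"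
    and fin: "finite ((\<lambda>x. (\<lambda>h. h \<circ> x) ` H) ` G)"
  shows "\<exists>n. \<forall>g\<in>G. fixes_level n g \<longrightarrow> g \<in> H"
proof -
  define N where "N = {g \<in> G. \<forall>x\<in>G. x \<circ> g \<circ> inv x \<in> H}"
  have N: "normal_sub N"
  proof -
    have id: "x \<circ> inv x = id" if "x \<in> G" for x using that by (simp add: fun_eq_iff)
    have comp: "x \<circ> (g \<circ> h) \<circ> inv x = (x \<circ> g \<circ> inv x) \<circ> (x \<circ> h \<circ> inv x)" if "x \<in> G" for x g h
      using that by (simp add: fun_eq_iff)
    have inv: "x \<circ> inv g \<circ> inv x = inv (x \<circ> g \<circ> inv x)" if "x \<in> G" "g \<in> G" for x g
      using that by (simp add: G_inv_comp G_comp G_inv comp_assoc)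
    have conj: "x \<circ> (y \<circ> g \<circ> inv y) \<circ> inv x = (x \<circ> y) \<circ> g \<circ> inv (x \<circ> y)" if "x \<in> G" "y \<in> G" for x y g
      using that by (simp add: G_inv_comp comp_assoc)
    show ?thesis
      unfolding normal_sub_def
    proof (intro conjI ballI)
      show "id \<in> N" using H by (simp add: N_def id)
      show "g \<circ> h \<in> N" if "g \<in> N" "h \<in> N" for g h
        using that H(3) unfolding N_def by (simp add: comp G_comp)
      show "inv g \<in> N" if "g \<in> N" for g
        using that H(4) unfolding N_def by (simp add: inv G_inv)
      show "y \<circ> g \<circ> inv y \<in> N" if "y \<in> G" "g \<in> N" for y g
        using that unfolding N_def by (simp add: conj G_comp G_inv)
    qed (auto simp: N_def)
  qed
  have N_H: "N \<subseteq> H"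
  proof
    fix g assume "g \<in> N"
    then have "id \<circ> g \<circ> inv id \<in> H" unfolding N_def using G_id by blast
    then show "g \<in> H" by simp
  qed
  define R where "R x = (\<lambda>h. h \<circ> x) ` H" for x :: "'p mod_ring list \<Rightarrow> 'p mod_ring list"
  \<comment> \<open>The action of \<open>g\<close> on right cosets, encoded as a graph so that its
    values lie in a finite power set.\<close>
  define \<phi> where "\<phi> g = (\<lambda>x. (R x, R (x \<circ> g))) ` G" for g
  have "\<phi> ` G \<subseteq> Pow (R ` G \<times> R ` G)" by (auto simp: \<phi>_def G_comp)
  moreover have "finite (Pow (R ` G \<times> R ` G))" using fin unfolding R_def by simp
  ultimately have "finite (\<phi> ` G)" by (rule finite_subset)
  then have "\<not> inj_on \<phi> G" using infinite_G finite_imageD by blast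
  then obtain g g' where g: "g \<in> G" "g' \<in> G" "\<phi> g = \<phi> g'" "g \<noteq> g'" by (auto simp: inj_on_def)
  have "x \<circ> (g \<circ> inv g') \<circ> inv x \<in> H" if x: "x \<in> G" for x
  proof -
    have "(R x, R (x \<circ> g)) \<in> \<phi> g'" unfolding g(3)[symmetric] using x by (simp add: \<phi>_def)
    then obtain x' where x': "x' \<in> G" "R x = R x'" "R (x \<circ> g) = R (x' \<circ> g')" by (auto simp: \<phi>_def)
    have self: "y \<in> R y" for y using H(2) unfolding R_def by (intro image_eqI[of _ _ id]) auto
    have "x' \<in> R x" "x \<circ> g \<in> R (x' \<circ> g')" using self x' by metis+
    then obtain h h' where h: "h \<in> H" "x' = h \<circ> x" "h' \<in> H" "x \<circ> g = h' \<circ> (x' \<circ> g')"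
      unfolding R_def by blast
    have "x (g w) = h' (h (x (g' w)))" for w
      using h(2,4) by (metis comp_apply)
    then have "x \<circ> (g \<circ> inv g') \<circ> inv x = h' \<circ> h" using g x by (simp add: fun_eq_iff)
    then show ?thesis using H(3) h by simp
  qed
  then have "g \<circ> inv g' \<in> N" using g by (simp add: N_def G_comp G_inv)
  moreover have "g \<circ> inv g' \<noteq> id"
  proof
    assume "g \<circ> inv g' = id"
    then have "g w = g' w" for w using g(2) by (metis G_inv_left comp_apply id_apply)
    then show False using g(4) by blast
  qed
  ultimately obtain n where "\<And>k. k \<in> K \<Longrightarrow> at_vertex (replicate n 0) k \<in> N"
    using normal_sub_contains_K_at_zeros[OF N] by blast
  then have "at_vertex v k \<in> N" if "length v = n" "k \<in> K" for v k
    using normal_sub_contains_K_at_vertex[OF N, of v k] that by simp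
  then have "g \<in> H" if "g \<in> G" "fixes_level (n + (degree f + 2)) g" for g
    using normal_sub_contains_stabilizer[OF N _ that] N_H by blast
  then show ?thesis by blast
qed

section \<open>The abstract group\<close>

lemma mult_Aut_tree:
  fixes g h :: "'x list \<Rightarrow> 'x list"
  shows "bij g \<Longrightarrow> bij h \<Longrightarrow> g \<otimes>\<^bsub>Aut_tree\<^esub> h = g \<circ> h"
  by (simp add: Aut_tree_def BijGroup_def Bij_def fun_eq_iff compose_def)

lemma one_Aut_tree: "\<one>\<^bsub>Aut_tree\<^esub> = id"
  by (simp add: Aut_tree_def BijGroup_def fun_eq_iff)

text \<open>Derived from the definition of \<open>m_inv\<close> and the membership of the inverse
  map, without first making \<open>Aut_tree\<close> a group.\<close>

lemma m_inv_Aut_tree: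
  assumes g: "g \<in> carrier Aut_tree" and inv_g: "inv g \<in> carrier Aut_tree"
  shows "m_inv Aut_tree g = inv g"
proof -
  have bij: "bij h" if "h \<in> carrier Aut_tree" for h :: "'a list \<Rightarrow> 'a list"
    using that by (simp add: Aut_tree_def Bij_def)
  show ?thesis
    unfolding m_inv_def
  proof (rule the_equality)
    show "inv g \<in> carrier Aut_tree \<and> g \<otimes>\<^bsub>Aut_tree\<^esub> inv g = \<one>\<^bsub>Aut_tree\<^esub>
        \<and> inv g \<otimes>\<^bsub>Aut_tree\<^esub> g = \<one>\<^bsub>Aut_tree\<^esub>"
      using g inv_g bij by (simp add: mult_Aut_tree one_Aut_tree fun_eq_iff bij_is_inj bij_is_surj surj_f_inv_f)
    fix h assume h: "h \<in> carrier Aut_tree \<and> g \<otimes>\<^bsub>Aut_tree\<^esub> h = \<one>\<^bsub>Aut_tree\<^esub>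
        \<and> h \<otimes>\<^bsub>Aut_tree\<^esub> g = \<one>\<^bsub>Aut_tree\<^esub>"
    then have "g \<circ> h = id" "h \<circ> g = id"
      using mult_Aut_tree[of g h] mult_Aut_tree[of h g] bij[OF g] bij[of h] one_Aut_tree by metis+
    then show "h = inv g" by (simp add: inv_unique_comp)
  qed
qed

lemma carrier_sunic_group: "carrier (sunic_group f) = G"
proof -
  let ?S = "range act_A \<union> act_B f ` V"
  have S: "?S \<subseteq> carrier Aut_tree"
    using act_A_in_Aut_tree act_B_in_Aut_tree[OF deg] by auto
  then have "carrier (sunic_group f) = generate Aut_tree ?S"
    by (simp add: sunic_group_def carrier_subgroup_generated inf_absorb2)
  also have "\<dots> = G"
  proof
    show "generate Aut_tree ?S \<subseteq> G"
    proof
      fix g assume "g \<in> generate Aut_tree ?S"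
      then show "g \<in> G"
      proof (induction rule: generate.induct)
        case one
        show "\<one>\<^bsub>Aut_tree\<^esub> \<in> G" by (simp add: one_Aut_tree)
      next
        case (incl h)
        then show ?case by auto
      next
        case (inv h)
        have "inv h \<in> ?S"
          using inv by (auto simp: inv_act_A inv_act_B)
        then have "m_inv Aut_tree h = inv h" using S inv by (intro m_inv_Aut_tree) auto
        then show ?case using inv by (auto simp: G_inv)
      next
        case (eng g h)
        then show "g \<otimes>\<^bsub>Aut_tree\<^esub> h \<in> G" by (simp add: mult_Aut_tree G_bij G_comp)
      qed
    qed
    have step: "s \<circ> g \<in> generate Aut_tree ?S" if "s \<in> ?S" "g \<in> G" "g \<in> generate Aut_tree ?S" for s g
    proof -
      have "bij s" using that(1) by (auto simp: bij_act_A bij_act_B)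
      then have "s \<otimes>\<^bsub>Aut_tree\<^esub> g = s \<circ> g" using that by (simp add: mult_Aut_tree G_bij)
      then show ?thesis using generate.eng[OF generate.incl[OF that(1)] that(3)] by simp
    qed
    show "G \<subseteq> generate Aut_tree ?S"
    proof
      fix g assume "g \<in> G"
      then show "g \<in> generate Aut_tree ?S"
      proof (induction rule: G_induct)
        show "id \<in> generate Aut_tree ?S" using generate.one[of Aut_tree ?S] by (simp add: one_Aut_tree)
        show "act_A k \<circ> g \<in> generate Aut_tree ?S" if "g \<in> G" "g \<in> generate Aut_tree ?S" for g k
          by (rule step) (use that in auto)
        show "act_B f z \<circ> g \<in> generate Aut_tree ?S"
          if "g \<in> G" "z \<in> V" "g \<in> generate Aut_tree ?S" for g z
          by (rule step) (use that in auto)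
      qed
    qed
  qed
  finally show ?thesis .
qed

lemma mult_sunic_group: "g \<in> G \<Longrightarrow> h \<in> G \<Longrightarrow> g \<otimes>\<^bsub>sunic_group f\<^esub> h = g \<circ> h"
  by (simp add: sunic_group_def mult_Aut_tree G_bij)

lemma one_sunic_group: "\<one>\<^bsub>sunic_group f\<^esub> = id"
  by (simp add: sunic_group_def one_Aut_tree)

lemma group_sunic_group: "group (sunic_group f)"
proof (rule groupI)
  fix g assume "g \<in> carrier (sunic_group f)"
  then have g: "g \<in> G" by (simp add: carrier_sunic_group)
  then have "inv g \<circ> g = id" by (simp add: fun_eq_iff)
  then show "\<exists>h\<in>carrier (sunic_group f). h \<otimes>\<^bsub>sunic_group f\<^esub> g = \<one>\<^bsub>sunic_group f\<^esub>"
    using g by (intro bexI[of _ "inv g"]) (simp_all add: carrier_sunic_group mult_sunic_group one_sunic_group G_inv)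
qed (simp_all add: carrier_sunic_group mult_sunic_group one_sunic_group G_comp comp_assoc)

lemma m_inv_sunic_group:
  assumes "g \<in> G"
  shows "m_inv (sunic_group f) g = inv g"
proof (rule group.inv_equality[OF group_sunic_group])
  have "inv g \<circ> g = id" using assms by (simp add: fun_eq_iff)
  then show "inv g \<otimes>\<^bsub>sunic_group f\<^esub> g = \<one>\<^bsub>sunic_group f\<^esub>"
    using assms by (simp add: mult_sunic_group one_sunic_group G_inv)
qed (use assms in \<open>simp_all add: carrier_sunic_group G_inv\<close>)

lemma congruence_subgroup_property_sunic_group: "congruence_subgroup_property (sunic_group f)"
  unfolding congruence_subgroup_property_def
proof (intro allI impI)
  fix H assume H: "subgroup H (sunic_group f) \<and> finite (rcosets\<^bsub>sunic_group f\<^esub> H)"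
  then have HG: "H \<subseteq> G" by (simp add: subgroup.subset flip: carrier_sunic_group)
  have "\<exists>n. \<forall>g\<in>G. fixes_level n g \<longrightarrow> g \<in> H"
  proof (rule finite_index_contains_stabilizer[OF HG])
    show "id \<in> H" using H subgroup.one_closed one_sunic_group by metis
    show "g \<circ> h \<in> H" if "g \<in> H" "h \<in> H" for g h
      using H subgroup.m_closed[of H "sunic_group f" g h] that mult_sunic_group[of g h] HG
      by (metis subsetD)
    show "inv g \<in> H" if "g \<in> H" for g
      using H subgroup.m_inv_closed[of H "sunic_group f" g] that m_inv_sunic_group[of g] HG
      by (metis subsetD)
    have "rcosets\<^bsub>sunic_group f\<^esub> H = (\<lambda>x. (\<lambda>h. h \<circ> x) ` H) ` G"
    proof -
      have "H #>\<^bsub>sunic_group f\<^esub> x = (\<lambda>h. h \<circ> x) ` H" if "x \<in> G" for x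
        unfolding r_coset_def using that HG by (auto simp: mult_sunic_group subset_iff)
      then show ?thesis by (auto simp: RCOSETS_def carrier_sunic_group)
    qed
    then show "finite ((\<lambda>x. (\<lambda>h. h \<circ> x) ` H) ` G)" using H by simp
  qed
  then show "\<exists>n. level_stabilizer (sunic_group f) n \<subseteq> H"
    by (auto simp: level_stabilizer_def carrier_sunic_group fixes_level_def)
qed

end

theorem theorem1p2:
  fixes f :: "'p::prime_card mod_ring poly"
  assumes "lead_coeff f = 1"
    and "degree f \<ge> 1"
    and "coeff f 0 \<noteq> 0"
    and not_infinite_dihedral: "\<not> (CARD('p) = 2 \<and> f = [:1, 1:])"
  shows "congruence_subgroup_property (sunic_group f)"
proof -
  \<comment> \<open>For p = 2 both coefficients of a monic polynomial of degree 1 with nonzero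
    constant term equal 1, which leaves only the excluded x + 1.\<close>
  have "degree f \<ge> 2" if two: "CARD('p) = 2"
  proof (rule ccontr)
    assume "\<not> degree f \<ge> 2"
    then have 1: "degree f = 1" using assms(2) by simp
    have "f = [:1, 1:]"
    proof (rule poly_eqI)
      fix n
      show "coeff f n = coeff [:1, 1:] n"
      proof (cases "n \<le> 1")
        case True
        then have "n = 0 \<or> n = 1" by auto
        moreover have "coeff f 0 = 1" using mod_ring_2_cases[OF two, of "coeff f 0"] assms(3) by simp
        ultimately show ?thesis using assms(1) 1 by auto
      next
        case False
        then show ?thesis using 1 by (auto simp: coeff_eq_0 coeff_pCons split: nat.split)
      qed
    qed
    with two not_infinite_dihedral show False by simp
  qed
  then have "sunic f" using assms(2,3) by unfold_locales
  then show ?thesis by (rule sunic.congruence_subgroup_property_sunic_group)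
qed

end
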